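(* Let $X$ be a real Banach space, let $[a,b]=[a_1,b_1]\times[a_2,b_2]\subset\mathbb{R}^2$ with $-\infty<a_i<b_i<+\infty$ for $i=1,2$, and let $f\in\mathcal{SM}[a,b]$ (so $f:[a,b]\to X$ is strongly McShane integrable). Let $$Z_1=\{t_1\in[a_1,b_1]: f_{t_1}\notin\mathcal{SM}[a_2,b_2]\},\qquad Z_2=\{t_2\in[a_2,b_2]: f_{t_2}\notin\mathcal{SM}[a_1,b_1]\},$$ $Z=(Z_1\times[a_2,b_2])\cup([a_1,b_1]\times Z_2)$ and $f_0=f\cdot\mathbf{1}_{[a,b]\setminus Z}$. Then the following statements hold. (i) $f_0\in\mathcal{SM}[a,b]$, and for each $(t_1,t_2)\in[a_1,b_1]\times[a_2,b_2]$ we have $(f_0)_{t_1}\in\mathcal{SM}[a_2,b_2]$ and $(f_0)_{t_2}\in\mathcal{SM}[a_1,b_1]$. (ii) The function $g(t_1)=(M)\int_{[a_2,b_2]}(f_0)_{t_1}$, for all $t_1\in[a_1,b_1]$, is strongly McShane integrable on $[a_1,b_1]$ and $$(M)\int_{[a_1,b_1]}\left((M)\int_{[a_2,b_2]}(f_0)_{t_1}\right)=(M)\int_{[a,b]}f.$$ (iii) The function $h(t_2)=(M)\int_{[a_1,b_1]}(f_0)_{t_2}$, for all $t_2\in[a_2,b_2]$, is strongly McShane integrable on $[a_2,b_2]$ and $$(M)\int_{[a_2,b_2]}\left((M)\int_{[a_1,b_1]}(f_0)_{t_2}\right)=(M)\int_{[a,b]}f.$$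
   Context: $X$ is a real Banach space with norm $\|\cdot\|$. Let $K$ be a compact non-degenerate interval in $\mathbb{R}^m$ with $m\in\{1,2\}$ (for $m=2$, a product $[a_1,b_1]\times[a_2,b_2]$ with $a_i<b_i$). $\mathbb{R}^2$ carries the maximum norm; $B(t,r)$ denotes the open ball with center $t$ and radius $r$ (for $m=1$ the open interval $(t-r,t+r)$). $|A|$ is the Lebesgue measure of $A$ and $A^o$ its interior. $\mathcal{I}_K$ is the family of all closed non-degenerate subintervals of $K$; $I,J\in\mathcal{I}_K$ are non-overlapping if $I^o\cap J^o=\emptyset$. An $\mathcal{M}$-partition in $K$ is a finite collection $P$ of pairs $(t,I)$ with $I\in\mathcal{I}_K$ and $t\in K$ (the tag $t$ need not lie in $I$) whose intervals are pairwise non-overlapping; it is an $\mathcal{M}$-partition of $K$ if moreover $\bigcup_{(t,I)\in P}I=K$. A gauge on $K$ is a function $\delta:K\to(0,+\infty)$; $P$ is $\delta$-fine if $I\subset B(t,\delta(t))$ for every $(t,I)\in P$. A function $F:\mathcal{I}_K\to X$ is an additive interval function if $F(I\cup J)=F(I)+F(J)$ for any two non-overlapping $I,J\in\mathcal{I}_K$ with $I\cup J\in\mathcal{I}_K$. A function $f:K\to X$ is strongly McShane integrable on $K$ if there is an additive interval function $F:\mathcal{I}_K\to X$ such that for every $\varepsilon>0$ there is a gauge $\delta$ on $K$ with $\sum_{(t,I)\in P}\|f(t)|I|-F(I)\|<\varepsilon$ for every $\delta$-fine $\mathcal{M}$-partition $P$ of $K$. $\mathcal{SM}(K)$ (written $\mathcal{SM}[a,b]$,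 $\mathcal{SM}[a_i,b_i]$) is the set of all such $X$-valued functions on $K$. In this case $f$ is McShane integrable on $K$ and $(M)\int_I f=F(I)$ for all $I\in\mathcal{I}_K$. For $f:[a,b]\to X$, $t_1\in[a_1,b_1]$ and $t_2\in[a_2,b_2]$, the sections are $f_{t_1}:[a_2,b_2]\to X$, $f_{t_1}(s_2)=f(t_1,s_2)$, and $f_{t_2}:[a_1,b_1]\to X$, $f_{t_2}(s_1)=f(s_1,t_2)$ (subscript $t_1$ fixes the first variable, subscript $t_2$ fixes the second). $\mathbf{1}_A$ denotes the indicator function of $A$. *)

theory Defs
  imports "HOL-Analysis.Analysis"
begin

section \<open>Intervals and M-partitions\<close>

text \<open>
  Everything is stated over an arbitrary Euclidean space and used for \<^typ>\<open>real\<close> and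
  \<^typ>\<open>real \<times> real\<close>. The norm of the product type \<^typ>\<open>real \<times> real\<close> is the
  Euclidean one, so the maximum norm is spelt \<^const>\<open>infnorm\<close> throughout.
\<close>

definition max_ball :: "'m::euclidean_space \<Rightarrow> real \<Rightarrow> 'm set" where
  "max_ball t r = {s. infnorm (s - t) < r}"

lemma infnorm_real_pair: "infnorm (x :: real \<times> real) = max \<bar>fst x\<bar> \<bar>snd x\<bar>"
proof -
  have "{\<bar>x \<bullet> i\<bar> |i. i \<in> Basis} = {\<bar>fst x\<bar>, \<bar>snd x\<bar>}"
    by (cases x) (force simp: Basis_prod_def)
  then show ?thesis
    by (simp add: infnorm_def cSup_insert sup_real_def)
qed

lemma max_ball_real: "max_ball (t::real) r = {t - r<..<t + r}"
  by (auto simp: max_ball_def infnorm_def)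

definition subintervals :: "'m::euclidean_space set \<Rightarrow> 'm set set" where
  "subintervals K = {I. I \<subseteq> K \<and> (\<exists>u v. box u v \<noteq> {} \<and> I = cbox u v)}"

definition non_overlapping :: "'m::euclidean_space set \<Rightarrow> 'm set \<Rightarrow> bool" where
  "non_overlapping I J \<longleftrightarrow> interior I \<inter> interior J = {}"

text \<open>
  Modelling the finite collection as a set of pairs loses nothing: a pair cannot be repeated,
  since a non-degenerate interval overlaps itself. For the same reason no interval occurs with
  two different tags.
\<close>

definition M_partition_in :: "('m::euclidean_space \<times> 'm set) set \<Rightarrow> 'm set \<Rightarrow> bool" where
  "M_partition_in P K \<longleftrightarrow>
     finite P \<and>
     (\<forall>(t, I) \<in> P. t \<in> K \<and> I \<in> subintervals K) \<and>
     (\<forall>p \<in> P. \<forall>q \<in> P. p \<noteq> q \<longrightarrow> non_overlapping (snd p) (snd q))"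

definition M_partition_of :: "('m::euclidean_space \<times> 'm set) set \<Rightarrow> 'm set \<Rightarrow> bool" where
  "M_partition_of P K \<longleftrightarrow> M_partition_in P K \<and> (\<Union>(t, I) \<in> P. I) = K"

definition gauge_on :: "('m::euclidean_space \<Rightarrow> real) \<Rightarrow> 'm set \<Rightarrow> bool" where
  "gauge_on \<delta> K \<longleftrightarrow> (\<forall>t \<in> K. 0 < \<delta> t)"

definition delta_fine :: "('m::euclidean_space \<Rightarrow> real) \<Rightarrow> ('m \<times> 'm set) set \<Rightarrow> bool" where
  "delta_fine \<delta> P \<longleftrightarrow> (\<forall>(t, I) \<in> P. I \<subseteq> max_ball t (\<delta> t))"

definition additive_interval_function ::
  "('m::euclidean_space set \<Rightarrow> 'x::real_normed_vector) \<Rightarrow> 'm set \<Rightarrow> bool" where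
  "additive_interval_function F K \<longleftrightarrow>
     (\<forall>I \<in> subintervals K. \<forall>J \<in> subintervals K.
        non_overlapping I J \<and> I \<union> J \<in> subintervals K \<longrightarrow> F (I \<union> J) = F I + F J)"


section \<open>The McShane and the strong McShane integral\<close>

text \<open>
  Functions on \<^term>\<open>K\<close> are total functions of which only the values on \<^term>\<open>K\<close> matter.
\<close>

definition strong_McShane_primitive ::
  "('m::euclidean_space \<Rightarrow> 'x::real_normed_vector) \<Rightarrow> ('m set \<Rightarrow> 'x) \<Rightarrow> 'm set \<Rightarrow> bool" where
  "strong_McShane_primitive f F K \<longleftrightarrow>
     additive_interval_function F K \<and>
     (\<forall>\<epsilon>>0. \<exists>\<delta>. gauge_on \<delta> K \<and>
        (\<forall>P. M_partition_of P K \<and> delta_fine \<delta> P \<longrightarrow>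
           (\<Sum>(t, I) \<in> P. norm (measure lebesgue I *\<^sub>R f t - F I)) < \<epsilon>))"

definition strongly_McShane_integrable ::
  "('m::euclidean_space \<Rightarrow> 'x::real_normed_vector) \<Rightarrow> 'm set \<Rightarrow> bool" where
  "strongly_McShane_integrable f K \<longleftrightarrow> (\<exists>F. strong_McShane_primitive f F K)"

definition has_McShane_integral ::
  "('m::euclidean_space \<Rightarrow> 'x::real_normed_vector) \<Rightarrow> 'x \<Rightarrow> 'm set \<Rightarrow> bool" where
  "has_McShane_integral f w K \<longleftrightarrow>
     (\<forall>\<epsilon>>0. \<exists>\<delta>. gauge_on \<delta> K \<and>
        (\<forall>P. M_partition_of P K \<and> delta_fine \<delta> P \<longrightarrow>
           norm ((\<Sum>(t, I) \<in> P. measure lebesgue I *\<^sub>R f t) - w) < \<epsilon>))"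

definition McShane_integral ::
  "'m::euclidean_space set \<Rightarrow> ('m \<Rightarrow> 'x::real_normed_vector) \<Rightarrow> 'x" where
  "McShane_integral K f = (THE w. has_McShane_integral f w K)"

lemma M_partition_of_division:
  assumes "M_partition_of P K"
  shows "(snd ` P) division_of K" and "inj_on snd P"
proof -
  have fin: "finite P" and sub: "\<And>p. p \<in> P \<Longrightarrow> snd p \<in> subintervals K"
    and non: "\<And>p q. p \<in> P \<Longrightarrow> q \<in> P \<Longrightarrow> p \<noteq> q \<Longrightarrow> non_overlapping (snd p) (snd q)"
    and un: "(\<Union>p \<in> P. snd p) = K"
    using assms by (auto simp: M_partition_of_def M_partition_in_def split_beta)
  have int: "interior (snd p) \<noteq> {}" if "p \<in> P" for p
    using sub[OF that] by (auto simp: subintervals_def interior_cbox)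
  show "inj_on snd P"
    using non int by (fastforce simp: inj_on_def non_overlapping_def)
  show "(snd ` P) division_of K"
  proof (rule division_ofI)
    fix I assume "I \<in> snd ` P"
    then have "I \<in> subintervals K" using sub by auto
    then show "I \<subseteq> K" "I \<noteq> {}" "\<exists>a b. I = cbox a b"
      using box_subset_cbox by (fastforce simp: subintervals_def)+
  next
    fix I J assume "I \<in> snd ` P" "J \<in> snd ` P" "I \<noteq> J"
    then show "interior I \<inter> interior J = {}"
      using non unfolding non_overlapping_def by blast
  qed (use fin un in auto)
qed

lemma additive_interval_function_division:
  fixes F :: "'m::euclidean_space set \<Rightarrow> 'x::real_normed_vector"
  assumes add: "additive_interval_function F (cbox a b)" and ne: "box a b \<noteq> {}"
    and div: "D division_of cbox a b" and int: "\<And>I. I \<in> D \<Longrightarrow> interior I \<noteq> {}"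
  shows "sum F D = F (cbox a b)"
proof -
  define G where "G S = (if interior (S \<inter> cbox a b) = {} then 0 else F (S \<inter> cbox a b))" for S
  have "operative (+) 0 G"
  proof (unfold_locales, goal_cases)
    case (1 u v)
    then show ?case
      by (simp add: G_def interior_cbox)
  next
    case (2 u v c k)
    obtain p q where pq: "cbox u v \<inter> cbox a b = cbox p q"
      by (rule that[OF Int_interval])
    let ?L = "cbox p q \<inter> {x. x \<bullet> k \<le> c}" and ?R = "cbox p q \<inter> {x. c \<le> x \<bullet> k}"
    have sub: "cbox p q \<subseteq> cbox a b" using pq by blast
    obtain q' where L: "?L = cbox p q'" using interval_split(1)[OF 2] by blast
    obtain p' where R: "?R = cbox p' q" using interval_split(2)[OF 2] by blast
    have un: "?L \<union> ?R = cbox p q" by auto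
    have eqs: "cbox u v \<inter> {x. x \<bullet> k \<le> c} \<inter> cbox a b = ?L"
      "cbox u v \<inter> {x. c \<le> x \<bullet> k} \<inter> cbox a b = ?R"
      using pq by blast+
    have G: "G (cbox u v) = (if box p q = {} then 0 else F (cbox p q))"
      "G (cbox u v \<inter> {x. x \<bullet> k \<le> c}) = (if box p q' = {} then 0 else F ?L)"
      "G (cbox u v \<inter> {x. c \<le> x \<bullet> k}) = (if box p' q = {} then 0 else F ?R)"
      unfolding G_def eqs pq by (simp_all add: L R interior_cbox)
    have ov: "interior ?L \<inter> interior ?R = {}"
      using interior_halfspace_le[of k c] interior_halfspace_ge[of k c] 2
      by (auto simp: inner_commute[of _ k] nonzero_Basis)
    have Lsub: "box p q' \<subseteq> box p q" "box p' q \<subseteq> box p q"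
      using interior_mono[OF Int_lower1, of "cbox p q"] unfolding L[symmetric] R[symmetric]
      by (metis L interior_cbox, metis R interior_cbox)
    consider "box p q = {}" | "box p q \<noteq> {}" "box p q' = {}" | "box p q \<noteq> {}" "box p' q = {}"
      | "box p q' \<noteq> {}" "box p' q \<noteq> {}" by blast
    then show ?case
    proof cases
      case 1
      then show ?thesis using Lsub by (simp add: G)
    next
      case 2
      have "cbox p q \<subseteq> ?R" 
      proof -
        have "box p q \<subseteq> ?R"
        proof
          fix x assume x: "x \<in> box p q"
          show "x \<in> ?R"
          proof (rule ccontr)
            assume "x \<notin> ?R"
            then have "x \<in> box p q \<inter> {x. x \<bullet> k < c}" using x box_subset_cbox by force
            moreover have "open (box p q \<inter> {x. x \<bullet> k < c})"
              by (intro open_Int open_box open_halfspace_component_lt)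
            moreover have "box p q \<inter> {x. x \<bullet> k < c} \<subseteq> ?L" using box_subset_cbox by force
            ultimately have "x \<in> interior ?L" by (meson interior_maximal subsetD)
            then show False using 2 by (simp add: L)
          qed
        qed
        then have "closure (box p q) \<subseteq> ?R"
          unfolding R by (intro closure_minimal) auto
        then show ?thesis using 2 by simp
      qed
      then have "?R = cbox p q" by auto
      moreover from this have "box p' q = box p q" using R by (metis interior_cbox)
      ultimately show ?thesis using 2 unfolding G by simp
    next
      case 3
      have "cbox p q \<subseteq> ?L" 
      proof -
        have "box p q \<subseteq> ?L"
        proof
          fix x assume x: "x \<in> box p q"
          show "x \<in> ?L"
          proof (rule ccontr)
            assume "x \<notin> ?L"
            then have "x \<in> box p q \<inter> {x. x \<bullet> k > c}" using x box_subset_cbox by force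
            moreover have "open (box p q \<inter> {x. x \<bullet> k > c})"
              by (intro open_Int open_box open_halfspace_component_gt)
            moreover have "box p q \<inter> {x. x \<bullet> k > c} \<subseteq> ?R" using box_subset_cbox by force
            ultimately have "x \<in> interior ?R" by (meson interior_maximal subsetD)
            then show False using 3 by (simp add: R)
          qed
        qed
        then have "closure (box p q) \<subseteq> ?L"
          unfolding L by (intro closure_minimal) auto
        then show ?thesis using 3 by simp
      qed
      then have "?L = cbox p q" by auto
      moreover from this have "box p q' = box p q" using L by (metis interior_cbox)
      ultimately show ?thesis using 3 unfolding G by simp
    next
      case 4
      then have ne': "box p q \<noteq> {}" using Lsub by blast
      have sI: "cbox x y \<in> subintervals (cbox a b)"
        if "box x y \<noteq> {}" "cbox x y \<subseteq> cbox p q" for x y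
        using that sub unfolding subintervals_def by blast
      have "?L \<in> subintervals (cbox a b)" "?R \<in> subintervals (cbox a b)"
        "cbox p q \<in> subintervals (cbox a b)"
        using sI[OF 4(1)] sI[OF 4(2)] sI[OF ne'] unfolding L[symmetric] R[symmetric] by simp_all
      then have "F (?L \<union> ?R) = F ?L + F ?R"
        using add ov un unfolding additive_interval_function_def non_overlapping_def by metis
      then show ?thesis using 4 ne' unfolding G un by simp
    qed
  qed
  from operative.division[OF this div]
  have "sum G D = G (cbox a b)" by (simp add: sum_def)
  moreover have "G I = F I" if "I \<in> D" for I
  proof -
    have "I \<inter> cbox a b = I" using that div by blast
    then show ?thesis using int[OF that] by (simp add: G_def)
  qed
  moreover have "G (cbox a b) = F (cbox a b)" using ne by (simp add: G_def)
  ultimately show ?thesis by simp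
qed

lemma fine_M_partition_exists:
  assumes ne: "box a b \<noteq> {}" and \<delta>: "gauge_on \<delta> (cbox a b)"
  obtains P where "M_partition_of P (cbox a b)" "delta_fine \<delta> P"
proof -
  define \<gamma> where "\<gamma> t = max_ball t (if t \<in> cbox a b then \<delta> t else 1)" for t
  have "gauge \<gamma>"
    unfolding gauge_def \<gamma>_def max_ball_def
    using \<delta> by (auto intro!: open_Collect_less continuous_intros simp: gauge_on_def infnorm_0)
  then obtain T where T: "T tagged_division_of cbox a b" "\<gamma> fine T"
    by (rule fine_division_exists)
  define P where "P = {(t, I) \<in> T. interior I \<noteq> {}}"
  have "{I \<in> snd ` T. measure lborel I \<noteq> 0} division_of cbox a b"
    using division_of_tagged_division[OF T(1)] ne
    by (intro division_of_nontrivial) (auto simp: content_eq_0_interior)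
  then have "\<Union> {I \<in> snd ` T. measure lborel I \<noteq> 0} = cbox a b" by blast
  moreover have "{I \<in> snd ` T. measure lborel I \<noteq> 0} = snd ` P"
  proof -
    have "measure lborel (snd z) \<noteq> 0 \<longleftrightarrow> interior (snd z) \<noteq> {}" if "z \<in> T" for z
      using tagged_division_ofD(4)[OF T(1), of "fst z" "snd z"] that
      by (metis content_eq_0_interior prod.collapse)
    then show ?thesis by (auto simp: P_def)
  qed
  ultimately have un: "(\<Union>(t, I) \<in> P. I) = cbox a b" by (simp add: split_beta)
  have "M_partition_in P (cbox a b)"
    unfolding M_partition_in_def
  proof (intro conjI ballI impI)
    show "finite P" using T(1) by (auto simp: P_def intro: finite_subset[of _ T])
  next
    fix z assume "z \<in> P"
    then obtain t I where z: "z = (t, I)" "(t, I) \<in> T" "interior I \<noteq> {}" by (auto simp: P_def)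
    from tagged_division_ofD(2,3,4)[OF T(1) z(2)] z(3)
    show "case z of (t, I) \<Rightarrow> t \<in> cbox a b \<and> I \<in> subintervals (cbox a b)"
      unfolding z(1) subintervals_def by (auto, metis empty_iff)
  next
    fix z y assume "z \<in> P" "y \<in> P" "z \<noteq> y"
    then show "non_overlapping (snd z) (snd y)"
      using tagged_division_ofD(5)[OF T(1), of "fst z" "snd z" "fst y" "snd y"]
      unfolding P_def non_overlapping_def
      by (metis (no_types, lifting) case_prodE mem_Collect_eq prod.collapse)
  qed
  moreover have "delta_fine \<delta> P"
    unfolding delta_fine_def
  proof (clarify)
    fix t I x assume "(t, I) \<in> P" "x \<in> I"
    then have "(t, I) \<in> T" by (simp add: P_def)
    then have "I \<subseteq> \<gamma> t" "t \<in> cbox a b"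
      using fineD[OF T(2)] tagged_division_ofD(2,3)[OF T(1), of t I] by auto
    then show "x \<in> max_ball t (\<delta> t)" using \<open>x \<in> I\<close> by (auto simp: \<gamma>_def)
  qed
  ultimately show thesis using that un by (simp add: M_partition_of_def)
qed

lemma has_McShane_integral_unique:
  assumes ne: "box a b \<noteq> {}"
    and w: "has_McShane_integral f w (cbox a b)" and w': "has_McShane_integral f w' (cbox a b)"
  shows "w = w'"
proof (rule ccontr)
  assume "w \<noteq> w'"
  define e where "e = norm (w - w') / 2"
  have e: "e > 0" using \<open>w \<noteq> w'\<close> by (simp add: e_def)
  let ?S = "\<lambda>P. \<Sum>(t, I) \<in> P. measure lebesgue I *\<^sub>R f t"
  obtain \<delta> where \<delta>: "gauge_on \<delta> (cbox a b)"
    "\<And>P. M_partition_of P (cbox a b) \<Longrightarrow> delta_fine \<delta> P \<Longrightarrow> norm (?S P - w) < e"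
    using w e unfolding has_McShane_integral_def by meson
  obtain \<delta>' where \<delta>': "gauge_on \<delta>' (cbox a b)"
    "\<And>P. M_partition_of P (cbox a b) \<Longrightarrow> delta_fine \<delta>' P \<Longrightarrow> norm (?S P - w') < e"
    using w' e unfolding has_McShane_integral_def by meson
  have "gauge_on (\<lambda>t. min (\<delta> t) (\<delta>' t)) (cbox a b)"
    using \<delta>(1) \<delta>'(1) by (simp add: gauge_on_def)
  then obtain P where P: "M_partition_of P (cbox a b)" "delta_fine (\<lambda>t. min (\<delta> t) (\<delta>' t)) P"
    using ne fine_M_partition_exists by blast
  have "delta_fine \<delta> P" "delta_fine \<delta>' P"
    using P(2) by (fastforce simp: delta_fine_def max_ball_def)+
  then have "norm (?S P - w) < e" "norm (?S P - w') < e" using P(1) \<delta>(2) \<delta>'(2) by blast+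
  then have "norm (w - w') < e + e" by norm
  then show False by (simp add: e_def)
qed

text \<open>
  On an interval the McShane integral of a strongly McShane integrable function exists and is
  the value of any primitive there, so the description in \<^const>\<open>McShane_integral\<close> denotes.
\<close>

theorem McShane_integral_eq_primitive:
  assumes ne: "box a b \<noteq> {}" and F: "strong_McShane_primitive f F (cbox a b)"
  shows "has_McShane_integral f (F (cbox a b)) (cbox a b)"
    and "McShane_integral (cbox a b) f = F (cbox a b)"
proof -
  have "norm ((\<Sum>(t, I) \<in> P. measure lebesgue I *\<^sub>R f t) - F (cbox a b))
        \<le> (\<Sum>(t, I) \<in> P. norm (measure lebesgue I *\<^sub>R f t - F I))"
    if P: "M_partition_of P (cbox a b)" for P
  proof -
    have "interior I \<noteq> {}" if "I \<in> snd ` P" for I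
      using that P unfolding M_partition_of_def M_partition_in_def subintervals_def by fastforce
    then have "sum F (snd ` P) = F (cbox a b)"
      using F ne M_partition_of_division(1)[OF P]
      by (intro additive_interval_function_division) (auto simp: strong_McShane_primitive_def)
    then have "(\<Sum>(t, I) \<in> P. F I) = F (cbox a b)"
      using M_partition_of_division(2)[OF P] by (simp add: sum.reindex split_beta)
    then have "(\<Sum>(t, I) \<in> P. measure lebesgue I *\<^sub>R f t) - F (cbox a b)
        = (\<Sum>(t, I) \<in> P. measure lebesgue I *\<^sub>R f t - F I)"
      by (simp add: split_beta sum_subtractf)
    then show ?thesis by (simp add: split_beta sum_norm_le)
  qed
  then show *: "has_McShane_integral f (F (cbox a b)) (cbox a b)"
    using F unfolding has_McShane_integral_def strong_McShane_primitive_def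
    by (meson le_less_trans)
  show "McShane_integral (cbox a b) f = F (cbox a b)"
    unfolding McShane_integral_def
    using * has_McShane_integral_unique[OF ne _ *] by (rule the_equality)
qed

end

theory Submission
  imports Defs
begin

text \<open>
  A function \<open>f\<close> on a box \<open>K\<close> is strongly McShane integrable if and only if, almost everywhere on
  \<open>K\<close>, it is the sum of a series \<open>(\<Sum>n. indicator (I n) t *\<^sub>R x n)\<close> with boxes \<open>I n\<close> and vectors
  \<open>x n\<close> such that \<open>norm (x n) * \<bar>I n\<bar>\<close> is summable. This is Mikusinski's description of the Bochner
  integrable functions, and the integral is then the sum of the \<open>\<bar>I n \<inter> K\<bar> *\<^sub>R x n\<close>. The theorem
  follows from it, because for series Fubini's theorem is almost immediate: a box in the product is
  a product of boxes \<open>A n \<times> B n\<close>, the section at \<open>s\<close> has the coefficients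
  \<open>indicator (A n) s *\<^sub>R x n\<close> on the boxes \<open>B n\<close>, and the marginal has the coefficients
  \<open>\<bar>B n\<bar> *\<^sub>R x n\<close> on the boxes \<open>A n\<close> (with \<open>B n\<close> cut down to the domain). What is needed from measure theory concerns real functions
  only: \<open>(\<Sum>n. norm (x n) * \<bar>B n\<bar> * indicator (A n) s)\<close> is finite for almost every \<open>s\<close>, and almost
  every section of a null set is a null set.

  A series yields a strong primitive (\<open>box_series_imp_strong_McShane_primitive\<close>) since a single
  indicator is harmless off the frontier of its box, and the tail of the series is dominated by a
  lower semicontinuous majorant of small integral, obtained by enlarging the boxes to open sets;
  lower semicontinuity is what a gauge can exploit when tags lie outside their intervals
  (\<open>eventually_Riemann_sum_le_open_series\<close>).

  Conversely (\<open>strong_McShane_primitive_imp_box_series\<close>), partitions \<open>P n\<close> that are fine for the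
  error \<open>1/4^n\<close> define step functions taking the value \<open>f t\<close> on \<open>I\<close> for \<open>(t, I) \<in> P n\<close>. Free tags
  give \<open>(\<Sum>norm (f t - f t') * \<bar>J\<bar>) \<le> \<epsilon> + \<epsilon>'\<close> whenever each \<open>J\<close> may be tagged by both \<open>t\<close> and
  \<open>t'\<close>. Applied to the common refinement of \<open>P n\<close> and \<open>P (n + 1)\<close> this bounds the \<open>L\<^sup>1\<close> distance of
  consecutive step functions; applied to a cover of the set where \<open>f\<close> is far from the \<open>n\<close>-th step
  function it bounds the outer measure of that set (\<open>strong_gauge_deviation_set\<close>), and the
  Borel-Cantelli lemma gives convergence to \<open>f\<close> almost everywhere.

  Finally \<open>Z1\<close> and \<open>Z2\<close> are null sets by Fubini's theorem for \<open>f\<close> and for \<open>f\<close> with its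
  variables exchanged, so \<open>f0\<close> equals \<open>f\<close> almost everywhere while all its sections have become
  integrable.
\<close>

section \<open>Fine partial partitions\<close>

lemma M_partition_in_piece:
  assumes "M_partition_in P K" "p \<in> P"
  shows "interior (snd p) \<noteq> {}" "snd p \<subseteq> K" "fst p \<in> K" "\<exists>u v. snd p = cbox u v"
proof -
  have "fst p \<in> K" "snd p \<in> subintervals K"
    using assms by (auto simp: M_partition_in_def split_beta)
  then show "interior (snd p) \<noteq> {}" "snd p \<subseteq> K" "fst p \<in> K" "\<exists>u v. snd p = cbox u v"
    by (auto simp: subintervals_def interior_cbox)
qed

lemma M_partition_in_disjoint:
  assumes "M_partition_in P K" "p \<in> P" "q \<in> P" "p \<noteq> q"
  shows "interior (snd p) \<inter> interior (snd q) = {}"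
  using assms by (auto simp: M_partition_in_def non_overlapping_def)

text \<open>
  The boxes of a partition in \<open>K\<close> are completed to a division of \<open>K\<close>, and every additional
  box is cut finely.
\<close>

lemma M_partition_extend:
  assumes ne: "box a b \<noteq> {}" and P: "M_partition_in P (cbox a b)" and fine: "delta_fine \<delta> P"
    and \<delta>: "gauge_on \<delta> (cbox a b)"
  obtains Q where "P \<subseteq> Q" "M_partition_of Q (cbox a b)" "delta_fine \<delta> Q"
proof -
  note piece = M_partition_in_piece[OF P] and disj = M_partition_in_disjoint[OF P]
  have finP: "finite P" using P by (simp add: M_partition_in_def)
  have "(snd ` P) division_of \<Union>(snd ` P)"
  proof (rule division_ofI)
    fix I assume "I \<in> snd ` P"
    then obtain p where p: "p \<in> P" "I = snd p" by blast
    then show "I \<noteq> {}" "\<exists>u v. I = cbox u v" "I \<subseteq> \<Union>(snd ` P)"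
      using piece[of p] by auto
  next
    fix I J assume "I \<in> snd ` P" "J \<in> snd ` P" "I \<noteq> J"
    then show "interior I \<inter> interior J = {}" using disj by blast
  qed (use finP in auto)
  moreover have "\<Union>(snd ` P) \<subseteq> cbox a b" using piece(2) by blast
  ultimately obtain q where q: "snd ` P \<subseteq> q" "q division_of cbox a b"
    by (rule partial_division_extend_interval)
  define D where "D = {I \<in> q. interior I \<noteq> {}}"
  have D_eq: "D = {I \<in> q. measure lborel I \<noteq> 0}"
    unfolding D_def using division_ofD(4)[OF q(2)] by (metis content_eq_0_interior)
  have D: "D division_of cbox a b"
    unfolding D_eq using division_of_nontrivial[OF q(2)] ne by (simp add: content_eq_0_interior)
  have PD: "snd ` P \<subseteq> D" using q(1) piece(1) by (auto simp: D_def)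
  have "\<exists>R. M_partition_of R I \<and> delta_fine \<delta> R" if I: "I \<in> D" for I
  proof -
    obtain u v where uv: "I = cbox u v" using division_ofD(4)[OF D I] by blast
    have "I \<subseteq> cbox a b" using division_ofD(2)[OF D I] .
    then have "gauge_on \<delta> I" using \<delta> by (auto simp: gauge_on_def)
    moreover have "box u v \<noteq> {}" using I by (auto simp: D_def uv interior_cbox)
    ultimately show ?thesis using fine_M_partition_exists uv by metis
  qed
  then obtain R where R: "\<And>I. I \<in> D \<Longrightarrow> M_partition_of (R I) I" "\<And>I. I \<in> D \<Longrightarrow> delta_fine \<delta> (R I)"
    by metis
  have Rin: "M_partition_in (R I) I" "(\<Union>p\<in>R I. snd p) = I" if "I \<in> D" for I
    using R(1)[OF that] by (auto simp: M_partition_of_def split_beta)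
  define Q where "Q = P \<union> (\<Union>I \<in> D - snd ` P. R I)"
  have origin: "\<exists>I\<in>D. snd p \<subseteq> I \<and> (if I \<in> snd ` P then p \<in> P \<and> I = snd p else p \<in> R I)"
    if p: "p \<in> Q" for p
  proof (cases "p \<in> P")
    case True
    then show ?thesis using PD by (intro bexI[of _ "snd p"]) auto
  next
    case False
    then obtain I where "I \<in> D - snd ` P" "p \<in> R I" using p unfolding Q_def by blast
    then show ?thesis using M_partition_in_piece(2)[OF Rin(1)] by (intro bexI[of _ I]) auto
  qed
  have "M_partition_in Q (cbox a b)"
    unfolding M_partition_in_def
  proof (intro conjI ballI impI)
    have "finite (R I)" if "I \<in> D" for I using Rin(1)[OF that] by (simp add: M_partition_in_def)
    then show "finite Q" using finP division_of_finite[OF D] by (auto simp: Q_def)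
  next
    fix p assume p: "p \<in> Q"
    show "case p of (t, I) \<Rightarrow> t \<in> cbox a b \<and> I \<in> subintervals (cbox a b)"
    proof (cases "p \<in> P")
      case True then show ?thesis using P by (auto simp: M_partition_in_def)
    next
      case False
      then obtain I where I: "I \<in> D" "p \<in> R I" using p unfolding Q_def by blast
      then have "I \<subseteq> cbox a b" using division_ofD(2)[OF D] by blast
      then show ?thesis
        using Rin(1)[OF I(1)] I(2) by (fastforce simp: M_partition_in_def subintervals_def)
    qed
  next
    fix p p' assume pp: "p \<in> Q" "p' \<in> Q" "p \<noteq> p'"
    obtain I where I: "I \<in> D" "snd p \<subseteq> I" "if I \<in> snd ` P then p \<in> P \<and> I = snd p else p \<in> R I"
      using origin[OF pp(1)] by blast
    obtain I' where I': "I' \<in> D" "snd p' \<subseteq> I'"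
      "if I' \<in> snd ` P then p' \<in> P \<and> I' = snd p' else p' \<in> R I'"
      using origin[OF pp(2)] by blast
    show "non_overlapping (snd p) (snd p')"
    proof (cases "I = I'")
      case True
      then show ?thesis
        using I I' pp(3) disj[of p p'] M_partition_in_disjoint[OF Rin(1)[OF I(1)], of p p']
        by (auto simp: non_overlapping_def split: if_splits)
    next
      case False
      then show ?thesis
        using division_ofD(5)[OF D I(1) I'(1)] interior_mono[OF I(2)] interior_mono[OF I'(2)]
        unfolding non_overlapping_def by blast
    qed
  qed
  moreover have "(\<Union>(t, I) \<in> Q. I) = cbox a b"
  proof -
    have "(\<Union>p \<in> Q. snd p) = \<Union>D"
      using PD Rin(2) origin unfolding Q_def by (auto simp: split_beta)
    then show ?thesis using division_ofD(6)[OF D] by (simp add: split_beta)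
  qed
  moreover have "delta_fine \<delta> Q" using fine R(2) unfolding delta_fine_def Q_def by blast
  ultimately show thesis using that[of Q] by (auto simp: Q_def M_partition_of_def)
qed

text \<open>
  The filter of sufficiently fine partial partitions: a property holds eventually if some gauge
  enforces it. It makes the choice of the minimum of several gauges implicit.
\<close>

definition fine_partitions :: "'m::euclidean_space set \<Rightarrow> ('m \<times> 'm set) set filter" where
  "fine_partitions K =
     (INF \<delta>\<in>{\<delta>. gauge_on \<delta> K}. principal {P. M_partition_in P K \<and> delta_fine \<delta> P})"

lemma eventually_fine_partitions:
  "eventually Q (fine_partitions K) \<longleftrightarrow>
     (\<exists>\<delta>. gauge_on \<delta> K \<and> (\<forall>P. M_partition_in P K \<and> delta_fine \<delta> P \<longrightarrow> Q P))"
  unfolding fine_partitions_def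
proof (subst eventually_INF_base)
  show "{\<delta>. gauge_on \<delta> K} \<noteq> {}" by (auto simp: gauge_on_def intro: exI[of _ "\<lambda>_. 1"])
next
  fix \<delta> \<delta>' assume "\<delta> \<in> {\<delta>. gauge_on \<delta> K}" "\<delta>' \<in> {\<delta>. gauge_on \<delta> K}"
  then have "(\<lambda>t. min (\<delta> t) (\<delta>' t)) \<in> {\<delta>. gauge_on \<delta> K}" by (auto simp: gauge_on_def)
  moreover have "delta_fine \<delta> P" "delta_fine \<delta>' P" if "delta_fine (\<lambda>t. min (\<delta> t) (\<delta>' t)) P" for P
    using that by (fastforce simp: delta_fine_def max_ball_def)+
  ultimately show "\<exists>\<delta>''\<in>{\<delta>. gauge_on \<delta> K}. principal {P. M_partition_in P K \<and> delta_fine \<delta>'' P}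
      \<le> inf (principal {P. M_partition_in P K \<and> delta_fine \<delta> P})
           (principal {P. M_partition_in P K \<and> delta_fine \<delta>' P})"
    by (intro bexI[of _ "\<lambda>t. min (\<delta> t) (\<delta>' t)"]) auto
qed (auto simp: eventually_principal)

lemma eventually_fine_partitions_M_partition:
  "eventually (\<lambda>P. M_partition_in P K) (fine_partitions K)"
  unfolding eventually_fine_partitions by (auto simp: gauge_on_def intro: exI[of _ "\<lambda>_. 1"])

text \<open>
  Since the summands are non-negative and every fine partial partition extends to a fine
  partition of \<open>K\<close>, partial partitions may be used in the definition of the strong integral.
\<close>

lemma strong_McShane_primitive_iff_fine_partitions:
  assumes ne: "box a b \<noteq> {}"
  shows "strong_McShane_primitive f F (cbox a b) \<longleftrightarrow>
    additive_interval_function F (cbox a b) \<and>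
    (\<forall>\<epsilon>>0. eventually (\<lambda>P. (\<Sum>p\<in>P. norm (measure lborel (snd p) *\<^sub>R f (fst p) - F (snd p))) < \<epsilon>)
       (fine_partitions (cbox a b)))"
proof -
  let ?S = "\<lambda>P. \<Sum>p\<in>P. norm (measure lborel (snd p) *\<^sub>R f (fst p) - F (snd p))"
  have lebesgue: "(\<Sum>(t, I)\<in>P. norm (measure lebesgue I *\<^sub>R f t - F I)) = ?S P"
    if P: "M_partition_of P (cbox a b)" for P
  proof -
    have "measure lebesgue (snd p) = measure lborel (snd p)" if "p \<in> P" for p
    proof -
      have "M_partition_in P (cbox a b)" using P by (simp add: M_partition_of_def)
      then obtain u v where "snd p = cbox u v" using M_partition_in_piece(4) \<open>p \<in> P\<close> by blast
      then show ?thesis by (simp add: measure_completion)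
    qed
    then show ?thesis by (auto simp: split_beta intro!: sum.cong)
  qed
  have "(\<forall>P. M_partition_of P (cbox a b) \<and> delta_fine \<delta> P \<longrightarrow> ?S P < \<epsilon>) \<longleftrightarrow>
        (\<forall>P. M_partition_in P (cbox a b) \<and> delta_fine \<delta> P \<longrightarrow> ?S P < \<epsilon>)"
    if \<delta>: "gauge_on \<delta> (cbox a b)" for \<delta> \<epsilon>
  proof (intro iffI allI impI; elim conjE)
    fix P assume *: "\<forall>P. M_partition_of P (cbox a b) \<and> delta_fine \<delta> P \<longrightarrow> ?S P < \<epsilon>"
      and P: "M_partition_in P (cbox a b)" "delta_fine \<delta> P"
    obtain Q where Q: "P \<subseteq> Q" "M_partition_of Q (cbox a b)" "delta_fine \<delta> Q"
      using M_partition_extend[OF ne P \<delta>] .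
    have "?S P \<le> ?S Q"
      using Q(1,2) by (intro sum_mono2) (auto simp: M_partition_of_def M_partition_in_def)
    also have "\<dots> < \<epsilon>" using * Q by blast
    finally show "?S P < \<epsilon>" .
  qed (auto simp: M_partition_of_def)
  then have "(\<forall>P. M_partition_of P (cbox a b) \<and> delta_fine \<delta> P \<longrightarrow>
          (\<Sum>(t, I)\<in>P. norm (measure lebesgue I *\<^sub>R f t - F I)) < \<epsilon>) \<longleftrightarrow>
        (\<forall>P. M_partition_in P (cbox a b) \<and> delta_fine \<delta> P \<longrightarrow> ?S P < \<epsilon>)"
    if "gauge_on \<delta> (cbox a b)" for \<delta> \<epsilon>
    using that lebesgue by (metis (lifting))
  then show ?thesis
    unfolding strong_McShane_primitive_def eventually_fine_partitions by blast
qed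

section \<open>Majorants of Riemann sums\<close>

lemma emeasure_lborel_cbox_measure:
  "emeasure lborel (cbox u v) = ennreal (measure lborel (cbox u v))"
  using emeasure_lborel_cbox_finite[of u v] by (simp add: emeasure_eq_ennreal_measure)

lemma null_sets_frontier_cbox: "frontier (cbox u v) \<in> null_sets lborel"
  using negligible_frontier_interval[of u v]
  by (simp add: negligible_iff_null_sets null_sets_completion_iff frontier_cbox)

lemma AE_indicator_interior_cbox:
  "AE t in lborel. indicator (interior (cbox u v)) t = (indicator (cbox u v) t :: ennreal)"
proof -
  have "AE t in lborel. t \<notin> frontier (cbox u v)" by (rule AE_not_in[OF null_sets_frontier_cbox])
  then show ?thesis
    by eventually_elim (auto simp: frontier_def indicator_def closure_closed dest: subsetD[OF box_subset_cbox])
qed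

text \<open>
  The boxes of a partition may share boundary points, which form a null set; their interiors are
  disjoint.
\<close>

lemma M_partition_in_nn_integral_le:
  assumes P: "M_partition_in P K" and \<psi>: "\<psi> \<in> borel_measurable borel"
  shows "(\<Sum>p\<in>P. \<integral>\<^sup>+t. \<psi> t * indicator (snd p) t \<partial>lborel) \<le> (\<integral>\<^sup>+t. \<psi> t \<partial>lborel)"
proof -
  have finP: "finite P" using P by (simp add: M_partition_in_def)
  have "(\<Sum>p\<in>P. \<integral>\<^sup>+t. \<psi> t * indicator (snd p) t \<partial>lborel)
      = (\<Sum>p\<in>P. \<integral>\<^sup>+t. \<psi> t * indicator (interior (snd p)) t \<partial>lborel)"
  proof (intro sum.cong refl nn_integral_cong_AE)
    fix p assume "p \<in> P"
    then obtain u v where uv: "snd p = cbox u v" using M_partition_in_piece(4)[OF P] by blast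
    show "AE t in lborel. \<psi> t * indicator (snd p) t = \<psi> t * indicator (interior (snd p)) t"
      using AE_indicator_interior_cbox[of u v] unfolding uv by eventually_elim simp
  qed
  also have "\<dots> = (\<integral>\<^sup>+t. (\<Sum>p\<in>P. \<psi> t * indicator (interior (snd p)) t) \<partial>lborel)"
    using \<psi> by (intro nn_integral_sum[symmetric]) simp
  also have "\<dots> \<le> (\<integral>\<^sup>+t. \<psi> t \<partial>lborel)"
  proof (rule nn_integral_mono)
    fix t
    have "disjoint_family_on (\<lambda>p. interior (snd p)) P"
      using M_partition_in_disjoint[OF P] by (auto simp: disjoint_family_on_def)
    then have "(\<Sum>p\<in>P. indicator (interior (snd p)) t) = (indicator (\<Union>p\<in>P. interior (snd p)) t :: ennreal)"
      using finP by (simp add: indicator_UN_disjoint)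
    then show "(\<Sum>p\<in>P. \<psi> t * indicator (interior (snd p)) t) \<le> \<psi> t"
      by (simp add: sum_distrib_left[symmetric] indicator_def)
  qed
  finally show ?thesis .
qed

lemma open_contains_max_ball:
  fixes t :: "'m::euclidean_space"
  assumes "open U" "t \<in> U"
  obtains r where "0 < r" "max_ball t r \<subseteq> U"
proof -
  obtain e where e: "e > 0" "ball t e \<subseteq> U" using assms openE by blast
  show thesis
  proof
    show "0 < e / sqrt DIM('m)" using e by simp
    show "max_ball t (e / sqrt DIM('m)) \<subseteq> U"
    proof
      fix s assume "s \<in> max_ball t (e / sqrt DIM('m))"
      then have "sqrt DIM('m) * infnorm (s - t) < e"
        by (simp add: max_ball_def pos_less_divide_eq mult.commute)
      then have "norm (s - t) < e" using norm_le_infnorm[of "s - t"] by linarith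
      then show "s \<in> U" using e(2) by (auto simp: dist_norm norm_minus_commute)
    qed
  qed
qed

text \<open>
  The majorant \<open>\<psi> t = (\<Sum>n. c n * indicator (U n) t)\<close> is lower semicontinuous, so that
  \<open>\<phi> t - e \<le> \<psi>\<close> holds on a whole neighbourhood of \<open>t\<close>. Hence a fine Riemann sum of \<open>\<phi>\<close> is
  bounded by the integral of \<open>\<psi> + e\<close>, wherever the tags lie.
\<close>

lemma eventually_Riemann_sum_le_open_series:
  fixes a b :: "'m::euclidean_space" and c :: "nat \<Rightarrow> ennreal"
  assumes \<phi>0: "\<And>t. 0 \<le> \<phi> t" and U: "\<And>n. open (U n)"
    and le: "\<And>t. t \<in> cbox a b \<Longrightarrow> ennreal (\<phi> t) \<le> (\<Sum>n. c n * indicator (U n) t)"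
    and C: "(\<Sum>n. c n * emeasure lborel (U n)) \<le> ennreal C" "0 \<le> C" and \<eta>: "0 < \<eta>"
  shows "\<forall>\<^sub>F P in fine_partitions (cbox a b).
    (\<Sum>p\<in>P. \<phi> (fst p) * measure lborel (snd p)) \<le> C + \<eta>"
proof -
  define \<psi> where "\<psi> t = (\<Sum>n. c n * indicator (U n) t)" for t
  have [measurable]: "U n \<in> sets borel" for n using U by simp
  have \<psi>[measurable]: "\<psi> \<in> borel_measurable borel" unfolding \<psi>_def by measurable
  have int\<psi>: "(\<integral>\<^sup>+t. \<psi> t \<partial>lborel) \<le> ennreal C"
    unfolding \<psi>_def using C by (subst nn_integral_suminf) (simp_all add: nn_integral_cmult_indicator)
  define V where "V = measure lborel (cbox a b)"
  define e where "e = \<eta> / (V + 1)"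
  have V: "0 \<le> V" by (simp add: V_def)
  have e: "0 < e" "e * V \<le> \<eta>" using \<eta> V by (auto simp: e_def field_simps)
  have "\<exists>r>0. \<forall>s\<in>max_ball t r. ennreal (\<phi> t - e) \<le> \<psi> s" if t: "t \<in> cbox a b" for t
  proof (cases "\<phi> t \<le> e")
    case True
    then show ?thesis by (intro exI[of _ 1]) (simp add: ennreal_neg)
  next
    case False
    then have "ennreal (\<phi> t - e) < ennreal (\<phi> t)" using e by (simp add: ennreal_less_iff)
    also have "\<dots> \<le> \<psi> t" using le[OF t] by (simp add: \<psi>_def)
    also have "\<psi> t = (SUP N. \<Sum>n<N. c n * indicator (U n) t)"
      unfolding \<psi>_def by (rule suminf_eq_SUP)
    finally obtain N where N: "ennreal (\<phi> t - e) < (\<Sum>n<N. c n * indicator (U n) t)"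
      by (auto simp: less_SUP_iff)
    define W where "W = (\<Inter>n\<in>{n\<in>{..<N}. t \<in> U n}. U n)"
    have "open W" "t \<in> W" unfolding W_def using U by auto
    then obtain r where r: "0 < r" "max_ball t r \<subseteq> W" by (rule open_contains_max_ball)
    have "ennreal (\<phi> t - e) \<le> \<psi> s" if "s \<in> max_ball t r" for s
    proof -
      have "s \<in> W" using that r by blast
      then have "(\<Sum>n<N. c n * indicator (U n) t) \<le> (\<Sum>n<N. c n * indicator (U n) s)"
        by (intro sum_mono mult_left_mono) (auto simp: W_def indicator_def)
      also have "\<dots> \<le> \<psi> s" unfolding \<psi>_def by (intro sum_le_suminf) auto
      finally show ?thesis using N by order
    qed
    then show ?thesis using r(1) by blast
  qed
  then obtain r where r: "\<And>t. t \<in> cbox a b \<Longrightarrow> 0 < r t"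
    "\<And>t s. t \<in> cbox a b \<Longrightarrow> s \<in> max_ball t (r t) \<Longrightarrow> ennreal (\<phi> t - e) \<le> \<psi> s"
    by metis
  have "(\<Sum>p\<in>P. \<phi> (fst p) * measure lborel (snd p)) \<le> C + \<eta>"
    if P: "M_partition_in P (cbox a b)" and fine: "delta_fine r P" for P
  proof -
    let ?\<chi> = "\<lambda>t. ennreal e * indicator (cbox a b) t + \<psi> t"
    have "ennreal (\<phi> (fst p) * measure lborel (snd p)) \<le> (\<integral>\<^sup>+s. ?\<chi> s * indicator (snd p) s \<partial>lborel)"
      if p: "p \<in> P" for p
    proof -
      note piece = M_partition_in_piece[OF P p]
      obtain u v where uv: "snd p = cbox u v" using piece(4) by blast
      have "ennreal (\<phi> (fst p) * measure lborel (snd p)) = ennreal (\<phi> (fst p)) * emeasure lborel (snd p)"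
        using \<phi>0 by (simp add: uv ennreal_mult emeasure_lborel_cbox_measure)
      also have "\<dots> = (\<integral>\<^sup>+s. ennreal (\<phi> (fst p)) * indicator (snd p) s \<partial>lborel)"
        by (simp add: uv nn_integral_cmult_indicator)
      also have "\<dots> \<le> (\<integral>\<^sup>+s. ?\<chi> s * indicator (snd p) s \<partial>lborel)"
      proof (rule nn_integral_mono)
        fix s
        show "ennreal (\<phi> (fst p)) * indicator (snd p) s \<le> ?\<chi> s * indicator (snd p) s"
        proof (cases "s \<in> snd p")
          case True
          then have s: "s \<in> max_ball (fst p) (r (fst p))" "s \<in> cbox a b"
            using fine p piece(2) by (auto simp: delta_fine_def split_beta)
          have "ennreal (\<phi> (fst p)) \<le> ennreal (e + max 0 (\<phi> (fst p) - e))"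
            by (intro ennreal_leI) auto
          also have "\<dots> = ennreal e + ennreal (\<phi> (fst p) - e)"
            using e by (simp add: ennreal_plus max_def ennreal_neg)
          also have "\<dots> \<le> ennreal e + \<psi> s"
            using r(2)[OF piece(3) s(1)] by (intro add_left_mono)
          finally show ?thesis using True s by simp
        qed simp
      qed
      finally show ?thesis .
    qed
    then have "(\<Sum>p\<in>P. ennreal (\<phi> (fst p) * measure lborel (snd p)))
        \<le> (\<Sum>p\<in>P. \<integral>\<^sup>+s. ?\<chi> s * indicator (snd p) s \<partial>lborel)" by (rule sum_mono)
    also have "\<dots> \<le> (\<integral>\<^sup>+s. ?\<chi> s \<partial>lborel)"
      by (rule M_partition_in_nn_integral_le[OF P]) measurable
    also have "\<dots> = ennreal e * emeasure lborel (cbox a b) + (\<integral>\<^sup>+s. \<psi> s \<partial>lborel)"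
      by (subst nn_integral_add) (simp_all add: nn_integral_cmult_indicator)
    also have "\<dots> = ennreal (e * V) + (\<integral>\<^sup>+s. \<psi> s \<partial>lborel)"
      using e V unfolding V_def
      by (simp add: ennreal_mult emeasure_lborel_cbox_measure)
    also have "\<dots> \<le> ennreal \<eta> + ennreal C"
      using e int\<psi> by (intro add_mono ennreal_leI)
    also have "\<dots> = ennreal (C + \<eta>)" using C \<eta> by (simp add: add.commute)
    finally show ?thesis using \<phi>0 C \<eta>
      by (simp add: sum_ennreal sum_nonneg del: ennreal_plus)
  qed
  moreover have "gauge_on r (cbox a b)" using r(1) by (simp add: gauge_on_def)
  ultimately show ?thesis unfolding eventually_fine_partitions by blast
qed

lemma outer_open_lborel:
  assumes "B \<in> sets borel" "0 < (e::real)"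
  obtains U where "open U" "B \<subseteq> U" "emeasure lborel U \<le> emeasure lborel B + ennreal e"
proof -
  obtain U where U: "open U" "B \<subseteq> U" "emeasure lborel (U - B) < ennreal e"
    using outer_regular_lborel[of B e] assms by auto
  have "emeasure lborel U \<le> emeasure lborel B + emeasure lborel (U - B)"
    using emeasure_subadditive[of B lborel "U - B"] U assms(1) by (simp add: Un_absorb1)
  also have "\<dots> \<le> emeasure lborel B + ennreal e" using U(3) by (intro add_left_mono) simp
  finally show thesis using U that by blast
qed

text \<open>
  Open sets \<open>U n \<supseteq> N\<close> whose measures form a small geometric series give the majorant
  \<open>\<Sum>n. indicator (U n)\<close>, which is infinite on \<open>N\<close> and therefore dominates any \<open>\<phi>\<close> there.
\<close>

lemma eventually_Riemann_sum_null_set: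
  fixes a b :: "'m::euclidean_space"
  assumes N: "N \<in> null_sets lborel" and \<phi>0: "\<And>t. 0 \<le> \<phi> t" and \<eta>: "0 < \<eta>"
  shows "\<forall>\<^sub>F P in fine_partitions (cbox a b).
    (\<Sum>p\<in>P. \<phi> (fst p) * indicator N (fst p) * measure lborel (snd p)) \<le> \<eta>"
proof -
  have "\<exists>U. open U \<and> N \<subseteq> U \<and> emeasure lborel U \<le> ennreal (\<eta> / 4 * (1/2)^n)" for n
    using outer_open_lborel[of N "\<eta> / 4 * (1/2)^n"] N \<eta> by (force simp: null_sets_def)
  then obtain U where U: "\<And>n. open (U n)" "\<And>n. N \<subseteq> U n"
    "\<And>n. emeasure lborel (U n) \<le> ennreal (\<eta> / 4 * (1/2)^n)" by metis
  have geo: "(\<lambda>n. \<eta> / 4 * (1/2)^n) sums (\<eta> / 4 * (1 / (1 - 1/2)))"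
    by (intro sums_mult geometric_sums) simp
  have "\<forall>\<^sub>F P in fine_partitions (cbox a b).
    (\<Sum>p\<in>P. (\<phi> (fst p) * indicator N (fst p)) * measure lborel (snd p)) \<le> \<eta> / 2 + \<eta> / 2"
  proof (rule eventually_Riemann_sum_le_open_series[where U = U and c = "\<lambda>_. 1"])
    fix t
    show "ennreal (\<phi> t * indicator N t) \<le> (\<Sum>n. 1 * indicator (U n) t)"
    proof (cases "t \<in> N")
      case True
      then have "t \<in> U n" for n using U by blast
      moreover obtain k where "\<phi> t \<le> real k" using real_arch_simple by blast
      then have "ennreal (\<phi> t) \<le> ennreal (real k)" by (rule ennreal_leI)
      ultimately have "ennreal (\<phi> t) \<le> (\<Sum>n<k. 1 * indicator (U n) t)"
        by (simp add: ennreal_of_nat_eq_real_of_nat)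
      also have "\<dots> \<le> (\<Sum>n. 1 * indicator (U n) t)" by (intro sum_le_suminf) auto
      finally show ?thesis using True by simp
    qed simp
  next
    have "(\<Sum>n. 1 * emeasure lborel (U n)) \<le> (\<Sum>n. ennreal (\<eta> / 4 * (1/2)^n))"
      using U by (intro suminf_le) auto
    also have "\<dots> = ennreal (\<eta> / 2)" using \<eta> sums_unique[OF geo] sums_summable[OF geo]
      by (subst suminf_ennreal2) auto
    finally show "(\<Sum>n. 1 * emeasure lborel (U n)) \<le> ennreal (\<eta> / 2)" .
  qed (use U \<phi>0 \<eta> in auto)
  then show ?thesis by simp
qed

text \<open>
  Enlarging the \<open>n\<close>-th box to an open set of slightly larger measure reduces this to open sets;
  the exceptional null set of the domination is dealt with separately.
\<close>

lemma eventually_Riemann_sum_le_box_series: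
  fixes a b :: "'m::euclidean_space" and u v :: "nat \<Rightarrow> 'm"
  assumes \<phi>0: "\<And>t. 0 \<le> \<phi> t" and c: "\<And>n. 0 \<le> c n"
    and sm: "summable (\<lambda>n. c n * measure lborel (cbox (u n) (v n)))"
    and le: "AE t in lborel. t \<in> cbox a b \<longrightarrow>
      ennreal (\<phi> t) \<le> (\<Sum>n. ennreal (c n) * indicator (cbox (u n) (v n)) t)"
    and \<eta>: "0 < \<eta>"
  shows "\<forall>\<^sub>F P in fine_partitions (cbox a b). (\<Sum>p\<in>P. \<phi> (fst p) * measure lborel (snd p))
    \<le> (\<Sum>n. c n * measure lborel (cbox (u n) (v n))) + \<eta>"
proof -
  let ?m = "\<lambda>n. measure lborel (cbox (u n) (v n))"
  define S where "S = (\<Sum>n. c n * ?m n)"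
  have S0: "0 \<le> S" unfolding S_def using c by (intro suminf_nonneg sm) auto
  \<comment> \<open>the admissible increase in measure of the \<open>n\<close>-th box; \<open>c n * e n\<close> sums to at most \<open>\<eta> / 4\<close>,
    and adding \<open>1\<close> covers the case \<open>c n = 0\<close>\<close>
  define e where "e n = \<eta> / 8 * (1/2)^n / (c n + 1)" for n
  have e: "0 < e n" "c n * e n \<le> \<eta> / 8 * (1/2)^n" for n
    using \<eta> c[of n] by (auto simp: e_def field_simps add_pos_nonneg)
  have "\<exists>U. open U \<and> cbox (u n) (v n) \<subseteq> U \<and> emeasure lborel U \<le> ennreal (?m n) + ennreal (e n)" for n
    using outer_open_lborel[of "cbox (u n) (v n)" "e n"] e(1)[of n]
    by (metis emeasure_lborel_cbox_measure cbox_borel)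
  then obtain U where U: "\<And>n. open (U n)" "\<And>n. cbox (u n) (v n) \<subseteq> U n"
    "\<And>n. emeasure lborel (U n) \<le> ennreal (?m n) + ennreal (e n)" by metis
  obtain N where N: "N \<in> null_sets lborel" "\<And>t. t \<notin> N \<Longrightarrow> t \<in> cbox a b \<Longrightarrow>
      ennreal (\<phi> t) \<le> (\<Sum>n. ennreal (c n) * indicator (cbox (u n) (v n)) t)"
    using le unfolding eventually_ae_filter by auto
  have geo: "(\<lambda>n. \<eta> / 8 * (1/2)^n) sums (\<eta> / 8 * (1 / (1 - 1/2)))"
    by (intro sums_mult geometric_sums) simp
  have "\<forall>\<^sub>F P in fine_partitions (cbox a b).
    (\<Sum>p\<in>P. (\<phi> (fst p) * indicator (- N) (fst p)) * measure lborel (snd p)) \<le> (S + \<eta> / 4) + \<eta> / 4"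
  proof (rule eventually_Riemann_sum_le_open_series[where U = U and c = "\<lambda>n. ennreal (c n)"])
    fix t assume t: "t \<in> cbox a b"
    have "(\<Sum>n. ennreal (c n) * indicator (cbox (u n) (v n)) t) \<le> (\<Sum>n. ennreal (c n) * indicator (U n) t)"
      using U(2) by (intro suminf_le mult_left_mono) (auto simp: indicator_def)
    then show "ennreal (\<phi> t * indicator (- N) t) \<le> (\<Sum>n. ennreal (c n) * indicator (U n) t)"
      using N(2)[OF _ t] by (cases "t \<in> N") (auto intro: order_trans)
  next
    have "(\<Sum>n. ennreal (c n) * emeasure lborel (U n)) \<le> (\<Sum>n. ennreal (c n * ?m n + \<eta> / 8 * (1/2)^n))"
    proof (intro suminf_le)
      fix n
      have "ennreal (c n) * emeasure lborel (U n) \<le> ennreal (c n) * (ennreal (?m n) + ennreal (e n))"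
        using U(3) by (intro mult_left_mono) auto
      also have "\<dots> = ennreal (c n * (?m n + e n))"
        using c[of n] e(1)[of n] by (simp add: ennreal_mult)
      also have "\<dots> \<le> ennreal (c n * ?m n + \<eta> / 8 * (1/2)^n)"
        using e(2)[of n] by (intro ennreal_leI) (simp add: distrib_left)
      finally show "ennreal (c n) * emeasure lborel (U n) \<le> ennreal (c n * ?m n + \<eta> / 8 * (1/2)^n)" .
    qed auto
    also have "\<dots> = ennreal (S + \<eta> / 4)"
      using c \<eta> sums_add[OF summable_sums[OF sm] geo]
      by (subst suminf_ennreal2) (auto simp: S_def sums_iff)
    finally show "(\<Sum>n. ennreal (c n) * emeasure lborel (U n)) \<le> ennreal (S + \<eta> / 4)" .
  qed (use U \<phi>0 \<eta> S0 in auto)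
  moreover have "\<forall>\<^sub>F P in fine_partitions (cbox a b).
    (\<Sum>p\<in>P. \<phi> (fst p) * indicator N (fst p) * measure lborel (snd p)) \<le> \<eta> / 2"
    using \<eta> by (intro eventually_Riemann_sum_null_set N \<phi>0) simp
  ultimately show ?thesis
  proof eventually_elim
    case (elim P)
    have "\<phi> (fst p) * measure lborel (snd p) = (\<phi> (fst p) * indicator (- N) (fst p)) * measure lborel (snd p)
       + \<phi> (fst p) * indicator N (fst p) * measure lborel (snd p)" for p :: "'m \<times> 'm set"
      by (simp add: indicator_def)
    then show ?case using elim by (simp add: sum.distrib S_def)
  qed
qed

text \<open>
  The gauge at a tag off the frontier is chosen such that fine intervals lie on the same side of
  the frontier as the tag, where the error vanishes. Tags on the frontier form a null set.
\<close>

lemma eventually_indicator_cbox_primitive: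
  fixes a b u v :: "'m::euclidean_space"
  assumes \<eta>: "0 < \<eta>"
  shows "\<forall>\<^sub>F P in fine_partitions (cbox a b).
    (\<Sum>p\<in>P. \<bar>indicator (cbox u v) (fst p) * measure lborel (snd p)
             - measure lborel (cbox u v \<inter> snd p)\<bar>) \<le> \<eta>"
proof -
  define N where "N = frontier (cbox u v)"
  have N: "N \<in> null_sets lborel"
    unfolding N_def by (rule null_sets_frontier_cbox)
  have "\<exists>r>0. t \<notin> N \<longrightarrow> max_ball t r \<subseteq> (if t \<in> cbox u v then cbox u v else - cbox u v)" for t
  proof (cases "t \<in> N")
    case True then show ?thesis by (auto intro: exI[of _ 1])
  next
    case False
    define W where "W = (if t \<in> cbox u v then interior (cbox u v) else - cbox u v)"
    have "open W" "t \<in> W"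
      using False by (auto simp: W_def N_def frontier_def closure_closed open_Compl)
    then obtain r where "0 < r" "max_ball t r \<subseteq> W" by (rule open_contains_max_ball)
    then show ?thesis using interior_subset[of "cbox u v"]
      by (intro exI[of _ r]) (auto simp: W_def split: if_splits)
  qed
  then obtain r where r: "\<And>t. 0 < r t"
    "\<And>t. t \<notin> N \<Longrightarrow> max_ball t (r t) \<subseteq> (if t \<in> cbox u v then cbox u v else - cbox u v)"
    by metis
  have "\<forall>\<^sub>F P in fine_partitions (cbox a b). M_partition_in P (cbox a b) \<and> delta_fine r P"
    unfolding eventually_fine_partitions using r(1) by (auto simp: gauge_on_def)
  moreover have "\<forall>\<^sub>F P in fine_partitions (cbox a b).
    (\<Sum>p\<in>P. 1 * indicator N (fst p) * measure lborel (snd p)) \<le> \<eta>"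
    by (intro eventually_Riemann_sum_null_set N \<eta>) simp
  ultimately show ?thesis
  proof eventually_elim
    case (elim P)
    have "\<bar>indicator (cbox u v) (fst p) * measure lborel (snd p) - measure lborel (cbox u v \<inter> snd p)\<bar>
        \<le> 1 * indicator N (fst p) * measure lborel (snd p)" if p: "p \<in> P" for p
    proof (cases "fst p \<in> N")
      case True
      obtain y z where yz: "snd p = cbox y z" using M_partition_in_piece(4) elim p by blast
      have "measure lborel (cbox u v \<inter> snd p) \<le> measure lborel (snd p)"
        unfolding yz by (intro measure_mono_fmeasurable) auto
      then show ?thesis using True by (auto simp: indicator_def)
    next
      case False
      have "snd p \<subseteq> max_ball (fst p) (r (fst p))" using elim p by (auto simp: delta_fine_def split_beta)
      then have "snd p \<subseteq> (if fst p \<in> cbox u v then cbox u v else - cbox u v)" using r(2)[OF False] by blast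
      then have "cbox u v \<inter> snd p = (if fst p \<in> cbox u v then snd p else {})"
        by (auto split: if_splits)
      then show ?thesis using False by simp
    qed
    then have "(\<Sum>p\<in>P. \<bar>indicator (cbox u v) (fst p) * measure lborel (snd p) - measure lborel (cbox u v \<inter> snd p)\<bar>)
       \<le> (\<Sum>p\<in>P. 1 * indicator N (fst p) * measure lborel (snd p))" by (rule sum_mono)
    then show ?case using elim by linarith
  qed
qed

section \<open>Series of boxes are strongly McShane integrable\<close>

text \<open>
  This presentation of Bochner integrable functions is due to Mikusinski. Almost everywhere the
  series converges absolutely, by the summability of \<open>norm (x n) * \<bar>I n\<bar>\<close>.
\<close>

definition has_box_series ::
  "('m::euclidean_space \<Rightarrow> 'x::banach) \<Rightarrow> (nat \<Rightarrow> 'x) \<Rightarrow> (nat \<Rightarrow> 'm) \<Rightarrow> (nat \<Rightarrow> 'm) \<Rightarrow> 'm set \<Rightarrow> bool" where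
  "has_box_series f x u v K \<longleftrightarrow>
     summable (\<lambda>n. norm (x n) * measure lborel (cbox (u n) (v n))) \<and>
     (AE t in lborel. t \<in> K \<longrightarrow> (\<lambda>n. indicator (cbox (u n) (v n)) t *\<^sub>R x n) sums f t)"

lemma AE_summable_indicator_cbox:
  assumes c: "\<And>n. 0 \<le> c n" and sm: "summable (\<lambda>n. c n * measure lborel (cbox (u n) (v n)))"
  shows "AE t in lborel. summable (\<lambda>n. c n * indicator (cbox (u n) (v n)) t :: real)"
proof -
  let ?f = "\<lambda>t. \<Sum>n. ennreal (c n * indicator (cbox (u n) (v n)) t)"
  have single: "(\<integral>\<^sup>+t. ennreal (c n * indicator (cbox (u n) (v n)) t) \<partial>lborel)
      = ennreal (c n * measure lborel (cbox (u n) (v n)))" for n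
  proof -
    have "(\<integral>\<^sup>+t. ennreal (c n * indicator (cbox (u n) (v n)) t) \<partial>lborel)
        = (\<integral>\<^sup>+t. ennreal (c n) * indicator (cbox (u n) (v n)) t \<partial>lborel)"
      by (intro nn_integral_cong) (simp add: indicator_def)
    also have "\<dots> = ennreal (c n * measure lborel (cbox (u n) (v n)))"
      using c by (simp add: nn_integral_cmult_indicator emeasure_lborel_cbox_measure ennreal_mult)
    finally show ?thesis .
  qed
  have "(\<integral>\<^sup>+t. ?f t \<partial>lborel) = (\<Sum>n. ennreal (c n * measure lborel (cbox (u n) (v n))))"
    by (subst nn_integral_suminf) (simp_all add: single)
  also have "\<dots> = ennreal (\<Sum>n. c n * measure lborel (cbox (u n) (v n)))"
    using c by (intro suminf_ennreal2 sm) auto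
  finally have "AE t in lborel. ?f t \<noteq> \<infinity>"
    by (intro nn_integral_PInf_AE) simp_all
  then show ?thesis
    by eventually_elim (rule summable_suminf_not_top, auto simp: c)
qed

lemma measure_cbox_Int_le: "measure lborel (cbox u v \<inter> cbox y z) \<le> measure lborel (cbox u v)"
  by (intro measure_mono_fmeasurable) auto

lemma M_partition_in_sum_measure_Int_le:
  assumes P: "M_partition_in P K"
  shows "(\<Sum>p\<in>P. measure lborel (cbox u v \<inter> snd p)) \<le> measure lborel (cbox u v)"
proof -
  have "(\<Sum>p\<in>P. ennreal (measure lborel (cbox u v \<inter> snd p)))
      = (\<Sum>p\<in>P. \<integral>\<^sup>+t. indicator (cbox u v) t * indicator (snd p) t \<partial>lborel)"
  proof (rule sum.cong)
    fix p assume "p \<in> P"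
    then obtain y z where yz: "snd p = cbox y z" using M_partition_in_piece(4)[OF P] by blast
    obtain y' z' where yz': "cbox u v \<inter> cbox y z = cbox y' z'" using Int_interval by blast
    show "ennreal (measure lborel (cbox u v \<inter> snd p))
        = (\<integral>\<^sup>+t. indicator (cbox u v) t * indicator (snd p) t \<partial>lborel)"
      unfolding yz by (simp add: indicator_inter_arith[symmetric] yz' emeasure_lborel_cbox_measure)
  qed simp
  also have "\<dots> \<le> (\<integral>\<^sup>+t. indicator (cbox u v) t \<partial>lborel)"
    by (rule M_partition_in_nn_integral_le[OF P]) simp
  also have "\<dots> = ennreal (measure lborel (cbox u v))" by (simp add: emeasure_lborel_cbox_measure)
  finally show ?thesis by (simp add: sum_ennreal sum_nonneg)
qed

lemma summable_box_series_Int: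
  assumes "summable (\<lambda>n. norm (x n :: 'x::banach) * measure lborel (cbox (u n) (v n)))"
  shows "summable (\<lambda>n. measure lborel (cbox (u n) (v n) \<inter> cbox y z) *\<^sub>R x n)"
    and "summable (\<lambda>n. norm (x n) * measure lborel (cbox (u n) (v n) \<inter> cbox y z))"
proof -
  show *: "summable (\<lambda>n. norm (x n) * measure lborel (cbox (u n) (v n) \<inter> cbox y z))"
    by (rule summable_comparison_test'[OF assms, of 0])
      (auto intro!: mult_left_mono measure_cbox_Int_le)
  show "summable (\<lambda>n. measure lborel (cbox (u n) (v n) \<inter> cbox y z) *\<^sub>R x n)"
    by (rule summable_norm_cancel) (use * in \<open>simp add: mult.commute\<close>)
qed

lemma measure_Int_Un_non_overlapping:
  assumes no: "interior (cbox y z) \<inter> interior (cbox y' z') = {}"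
  shows "measure lborel (cbox u v \<inter> (cbox y z \<union> cbox y' z'))
    = measure lborel (cbox u v \<inter> cbox y z) + measure lborel (cbox u v \<inter> cbox y' z')"
proof -
  obtain p q where pq1: "cbox u v \<inter> cbox y z = cbox p q" by (rule that[OF Int_interval])
  obtain p' q' where pq2: "cbox u v \<inter> cbox y' z' = cbox p' q'" by (rule that[OF Int_interval])
  note pq = pq1 pq2
  have "interior (cbox p q) \<inter> interior (cbox p' q') = {}"
    using no interior_mono[of "cbox p q" "cbox y z"] interior_mono[of "cbox p' q'" "cbox y' z'"]
    unfolding pq[symmetric] by blast
  then have "negligible (cbox p q \<inter> cbox p' q')"
    by (simp add: negligible_convex_interior convex_Int interior_Int del: interior_cbox)
  then have "measure lebesgue (cbox p q \<inter> cbox p' q') = 0" by (rule negligible_imp_measure0)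
  then have "measure lborel (cbox p q \<inter> cbox p' q') = 0" by (subst (asm) measure_completion) auto
  then show ?thesis unfolding Int_Un_distrib pq by (simp add: measure_Un3)
qed

text \<open>
  The primitive is integrated term by term. Of the finitely many terms in front, each is an
  indicator and harmless; what the tail contributes to a fine Riemann sum and to the primitive
  is at most slightly more than the remaining sum of the \<open>norm (x n) * \<bar>I n\<bar>\<close>.
\<close>

theorem box_series_imp_strong_McShane_primitive:
  fixes a b :: "'m::euclidean_space" and f :: "'m \<Rightarrow> 'x::banach"
  assumes ne: "box a b \<noteq> {}" and f: "has_box_series f x u v (cbox a b)"
  shows "strong_McShane_primitive f
    (\<lambda>J. \<Sum>n. measure lborel (cbox (u n) (v n) \<inter> J) *\<^sub>R x n) (cbox a b)"
proof -
  let ?I = "\<lambda>n. cbox (u n) (v n)"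
  define F where "F J = (\<Sum>n. measure lborel (?I n \<inter> J) *\<^sub>R x n)" for J
  have sm: "summable (\<lambda>n. norm (x n) * measure lborel (?I n))"
    and ae: "AE t in lborel. t \<in> cbox a b \<longrightarrow> (\<lambda>n. indicator (?I n) t *\<^sub>R x n) sums f t"
    using f by (auto simp: has_box_series_def)
  have "additive_interval_function F (cbox a b)"
    unfolding additive_interval_function_def
  proof (intro ballI impI)
    fix I J assume "I \<in> subintervals (cbox a b)" "J \<in> subintervals (cbox a b)"
      and no: "non_overlapping I J \<and> I \<union> J \<in> subintervals (cbox a b)"
    then obtain y z y' z' where IJ: "I = cbox y z" "J = cbox y' z'" by (auto simp: subintervals_def)
    show "F (I \<union> J) = F I + F J"
      unfolding F_def IJ using no
      by (simp add: measure_Int_Un_non_overlapping non_overlapping_def IJ scaleR_add_left suminf_add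
          summable_box_series_Int[OF sm] del: interior_cbox)
  qed
  moreover have "\<forall>\<^sub>F P in fine_partitions (cbox a b).
    (\<Sum>p\<in>P. norm (measure lborel (snd p) *\<^sub>R f (fst p) - F (snd p))) < \<epsilon>" if \<epsilon>: "0 < \<epsilon>" for \<epsilon>
  proof -
    obtain M where M: "(\<Sum>n. norm (x (n + M)) * measure lborel (?I (n + M))) < \<epsilon> / 8"
    proof -
      obtain M where "\<forall>n\<ge>M. norm (\<Sum>i. norm (x (i + n)) * measure lborel (?I (i + n))) < \<epsilon> / 8"
        using suminf_exist_split[OF _ sm, of "\<epsilon> / 8"] \<epsilon> by auto
      then show thesis by (intro that[of M]) (auto dest: spec[of _ M])
    qed
    have smM: "summable (\<lambda>n. norm (x (n + M)) * measure lborel (?I (n + M)))"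
      using summable_iff_shift[of "\<lambda>n. norm (x n) * measure lborel (?I n)" M] sm by simp
    define \<phi> where "\<phi> t = norm (f t - (\<Sum>n<M. indicator (?I n) t *\<^sub>R x n))" for t
    define d where "d n J t = \<bar>indicator (?I n) t * measure lborel J - measure lborel (?I n \<inter> J)\<bar>" for n J t
    \<comment> \<open>chosen such that the errors \<open>norm (x n) * \<eta> n\<close> of the first \<open>M\<close> terms sum to at most \<open>\<epsilon> / 4\<close>\<close>
    define \<eta> where "\<eta> n = \<epsilon> / (4 * (real M + 1) * (norm (x n) + 1))" for n
    have \<eta>: "0 < \<eta> n" for n
      using \<epsilon> by (simp add: \<eta>_def add_nonneg_pos)
    have head: "\<forall>\<^sub>F P in fine_partitions (cbox a b). \<forall>n\<in>{..<M}. (\<Sum>p\<in>P. d n (snd p) (fst p)) \<le> \<eta> n"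
      unfolding d_def by (intro eventually_ball_finite ballI eventually_indicator_cbox_primitive \<eta>) simp
    have "AE t in lborel. t \<in> cbox a b \<longrightarrow>
      ennreal (\<phi> t) \<le> (\<Sum>n. ennreal (norm (x (n + M))) * indicator (?I (n + M)) t)"
      using ae AE_summable_indicator_cbox[OF norm_ge_zero smM]
    proof (eventually_elim, intro impI)
      fix t assume t: "t \<in> cbox a b \<longrightarrow> (\<lambda>n. indicator (?I n) t *\<^sub>R x n) sums f t" "t \<in> cbox a b"
        and abs: "summable (\<lambda>n. norm (x (n + M)) * indicator (?I (n + M)) t)"
      have "(\<lambda>n. indicator (?I (n + M)) t *\<^sub>R x (n + M)) sums (f t - (\<Sum>n<M. indicator (?I n) t *\<^sub>R x n))"
        using t sums_iff_shift[of "\<lambda>n. indicator (?I n) t *\<^sub>R x n" M] by simp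
      then have "\<phi> t = norm (\<Sum>n. indicator (?I (n + M)) t *\<^sub>R x (n + M))"
        by (simp add: \<phi>_def sums_iff)
      also have "\<dots> \<le> (\<Sum>n. norm (x (n + M)) * indicator (?I (n + M)) t)"
        using abs by (intro order_trans[OF summable_norm]) (simp_all add: mult.commute)
      finally have "ennreal (\<phi> t) \<le> ennreal (\<Sum>n. norm (x (n + M)) * indicator (?I (n + M)) t)"
        by (rule ennreal_leI)
      also have "\<dots> = (\<Sum>n. ennreal (norm (x (n + M)) * indicator (?I (n + M)) t))"
        using abs by (intro suminf_ennreal2[symmetric]) auto
      also have "\<dots> = (\<Sum>n. ennreal (norm (x (n + M))) * indicator (?I (n + M)) t)"
        by (intro suminf_cong) (simp add: indicator_def)
      finally show "ennreal (\<phi> t) \<le> (\<Sum>n. ennreal (norm (x (n + M))) * indicator (?I (n + M)) t)" .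
    qed
    then have "\<forall>\<^sub>F P in fine_partitions (cbox a b). (\<Sum>p\<in>P. \<phi> (fst p) * measure lborel (snd p))
        \<le> (\<Sum>n. norm (x (n + M)) * measure lborel (?I (n + M))) + \<epsilon> / 8"
      using \<epsilon> smM by (intro eventually_Riemann_sum_le_box_series) (auto simp: \<phi>_def)
    with head eventually_fine_partitions_M_partition[of "cbox a b"]
    show ?thesis
    proof eventually_elim
      case (elim P)
      note P = elim(2)
      let ?T = "\<lambda>J. \<Sum>n. norm (x (n + M)) * measure lborel (?I (n + M) \<inter> J)"
      have smJ: "summable (\<lambda>n. norm (x (n + M)) * measure lborel (?I (n + M) \<inter> snd p))" if p: "p \<in> P" for p
      proof -
        obtain y z where "snd p = cbox y z" using M_partition_in_piece(4)[OF P p] by blast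
        then show ?thesis by (simp only: summable_box_series_Int(2)[OF smM])
      qed
      have split: "norm (measure lborel (snd p) *\<^sub>R f (fst p) - F (snd p))
          \<le> \<phi> (fst p) * measure lborel (snd p) + (\<Sum>n<M. norm (x n) * d n (snd p) (fst p)) + ?T (snd p)"
        if p: "p \<in> P" for p
      proof -
        obtain t J where tJ: "p = (t, J)" by force
        obtain y z where yz: "J = cbox y z" using M_partition_in_piece(4)[OF P p] tJ by auto
        let ?g = "\<lambda>n. measure lborel (?I n \<inter> J) *\<^sub>R x n"
        have smg: "summable ?g" unfolding yz by (rule summable_box_series_Int[OF sm])
        have F: "F J = (\<Sum>n. ?g (n + M)) + (\<Sum>n<M. ?g n)"
          unfolding F_def by (rule suminf_split_initial_segment[OF smg])
        define H where "H = measure lborel J *\<^sub>R (f t - (\<Sum>n<M. indicator (?I n) t *\<^sub>R x n))"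
        define D where "D = (\<Sum>n<M. (indicator (?I n) t * measure lborel J - measure lborel (?I n \<inter> J)) *\<^sub>R x n)"
        define T where "T = (\<Sum>n. ?g (n + M))"
        have "measure lborel J *\<^sub>R (\<Sum>n<M. indicator (?I n) t *\<^sub>R x n)
            = (\<Sum>n<M. (indicator (?I n) t * measure lborel J) *\<^sub>R x n)"
          unfolding scaleR_sum_right scaleR_scaleR by (intro sum.cong refl) (simp only: mult.commute)
        moreover have "A - (T + G) = A - S + (S - G) - T" for A S T G :: 'x by simp
        ultimately have "measure lborel J *\<^sub>R f t - F J = H + D - T"
          unfolding F H_def D_def T_def scaleR_diff_right scaleR_diff_left sum_subtractf by (simp only:)
        moreover have "norm (H + D - T) \<le> norm H + norm D + norm T"
          by (rule order_trans[OF norm_triangle_ineq4 add_right_mono[OF norm_triangle_ineq]])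
        moreover have "norm H = \<phi> t * measure lborel J" by (simp add: H_def \<phi>_def mult.commute)
        moreover have "norm D \<le> (\<Sum>n<M. norm (x n) * d n J t)"
          unfolding D_def
          by (rule order_trans[OF norm_sum]) (simp add: d_def mult.commute)
        moreover have "norm T \<le> ?T J"
          unfolding T_def using smJ[OF p] summable_norm[of "\<lambda>n. ?g (n + M)"]
          by (simp add: tJ mult.commute)
        ultimately show ?thesis by (simp add: tJ)
      qed
      have "(\<Sum>p\<in>P. norm (measure lborel (snd p) *\<^sub>R f (fst p) - F (snd p)))
        \<le> (\<Sum>p\<in>P. \<phi> (fst p) * measure lborel (snd p))
          + (\<Sum>p\<in>P. \<Sum>n<M. norm (x n) * d n (snd p) (fst p)) + (\<Sum>p\<in>P. ?T (snd p))"
        using sum_mono[OF split] by (simp add: sum.distrib)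
      moreover have "(\<Sum>p\<in>P. \<Sum>n<M. norm (x n) * d n (snd p) (fst p)) \<le> \<epsilon> / 4"
      proof -
        have "(\<Sum>p\<in>P. \<Sum>n<M. norm (x n) * d n (snd p) (fst p))
            = (\<Sum>n<M. norm (x n) * (\<Sum>p\<in>P. d n (snd p) (fst p)))"
          by (subst sum.swap) (simp add: sum_distrib_left)
        also have "\<dots> \<le> (\<Sum>n<M. \<epsilon> / (4 * (real M + 1)))"
        proof (rule sum_mono)
          fix n assume "n \<in> {..<M}"
          then have "norm (x n) * (\<Sum>p\<in>P. d n (snd p) (fst p)) \<le> norm (x n) * \<eta> n"
            using elim(1) by (intro mult_left_mono) auto
          also have "\<dots> = \<epsilon> / (4 * (real M + 1)) * (norm (x n) / (norm (x n) + 1))"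
            by (simp add: \<eta>_def)
          also have "\<dots> \<le> \<epsilon> / (4 * (real M + 1)) * 1"
            using \<epsilon> by (intro mult_left_mono) (auto simp: divide_le_eq add_nonneg_pos)
          finally show "norm (x n) * (\<Sum>p\<in>P. d n (snd p) (fst p)) \<le> \<epsilon> / (4 * (real M + 1))" by simp
        qed
        also have "\<dots> \<le> \<epsilon> / 4" using \<epsilon> by (simp add: field_simps)
        finally show ?thesis .
      qed
      moreover have "(\<Sum>p\<in>P. ?T (snd p)) \<le> (\<Sum>n. norm (x (n + M)) * measure lborel (?I (n + M)))"
      proof -
        have "(\<Sum>p\<in>P. ?T (snd p))
            = (\<Sum>n. \<Sum>p\<in>P. norm (x (n + M)) * measure lborel (?I (n + M) \<inter> snd p))"
          using smJ by (intro suminf_sum[symmetric])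
        also have "\<dots> \<le> (\<Sum>n. norm (x (n + M)) * measure lborel (?I (n + M)))"
        proof (intro suminf_le smM summable_sum smJ)
          fix n
          show "(\<Sum>p\<in>P. norm (x (n + M)) * measure lborel (?I (n + M) \<inter> snd p))
              \<le> norm (x (n + M)) * measure lborel (?I (n + M))"
            unfolding sum_distrib_left[symmetric]
            by (intro mult_left_mono M_partition_in_sum_measure_Int_le[OF P]) simp
        qed
        finally show ?thesis .
      qed
      ultimately show ?case using elim(3) M \<epsilon> by linarith
    qed
  qed
  ultimately show ?thesis
    unfolding strong_McShane_primitive_iff_fine_partitions[OF ne] F_def by blast
qed

section \<open>Gauges with small error and two systems of tags\<close>

definition strong_gauge ::
  "('m::euclidean_space \<Rightarrow> 'x::real_normed_vector) \<Rightarrow> ('m set \<Rightarrow> 'x) \<Rightarrow> 'm set \<Rightarrow> real \<Rightarrow> ('m \<Rightarrow> real) \<Rightarrow> bool" where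
  "strong_gauge f F K \<epsilon> \<delta> \<longleftrightarrow> gauge_on \<delta> K \<and> (\<forall>P. M_partition_in P K \<and> delta_fine \<delta> P \<longrightarrow>
     (\<Sum>p\<in>P. norm (measure lborel (snd p) *\<^sub>R f (fst p) - F (snd p))) < \<epsilon>)"

lemma strong_gauge_indexed:
  assumes g: "strong_gauge f F K \<epsilon> \<delta>" and fin: "finite A"
    and sub: "\<And>i. i \<in> A \<Longrightarrow> J i \<in> subintervals K" and tag: "\<And>i. i \<in> A \<Longrightarrow> \<tau> i \<in> K"
    and disj: "\<And>i j. i \<in> A \<Longrightarrow> j \<in> A \<Longrightarrow> i \<noteq> j \<Longrightarrow> interior (J i) \<inter> interior (J j) = {}"
    and fine: "\<And>i. i \<in> A \<Longrightarrow> J i \<subseteq> max_ball (\<tau> i) (\<delta> (\<tau> i))"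
  shows "(\<Sum>i\<in>A. norm (measure lborel (J i) *\<^sub>R f (\<tau> i) - F (J i))) < \<epsilon>"
proof -
  have ne: "interior (J i) \<noteq> {}" if "i \<in> A" for i
    using sub[OF that] by (auto simp: subintervals_def interior_cbox)
  have inj: "inj_on (\<lambda>i. (\<tau> i, J i)) A"
  proof (rule inj_onI)
    fix i j assume "i \<in> A" "j \<in> A" "(\<tau> i, J i) = (\<tau> j, J j)"
    then show "i = j" using ne[of i] disj[of i j] by auto
  qed
  let ?P = "(\<lambda>i. (\<tau> i, J i)) ` A"
  have "M_partition_in ?P K"
    unfolding M_partition_in_def non_overlapping_def
  proof (intro conjI ballI impI)
    fix p q assume "p \<in> ?P" "q \<in> ?P" "p \<noteq> q"
    then obtain i j where "i \<in> A" "j \<in> A" "p = (\<tau> i, J i)" "q = (\<tau> j, J j)" "i \<noteq> j"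
      by blast
    then show "interior (snd p) \<inter> interior (snd q) = {}" using disj by simp
  qed (use fin sub tag in auto)
  moreover have "delta_fine \<delta> ?P" using fine by (auto simp: delta_fine_def)
  ultimately have "(\<Sum>p\<in>?P. norm (measure lborel (snd p) *\<^sub>R f (fst p) - F (snd p))) < \<epsilon>"
    using g unfolding strong_gauge_def by blast
  then show ?thesis by (simp add: sum.reindex[OF inj])
qed

text \<open>
  The values of the primitive cancel in the difference of the two sums, because the tags are not
  bound to their intervals.
\<close>

lemma strong_gauge_two_tags:
  assumes g: "strong_gauge f F K \<epsilon> \<delta>" "strong_gauge f F K \<epsilon>' \<delta>'" and fin: "finite A"
    and sub: "\<And>i. i \<in> A \<Longrightarrow> J i \<in> subintervals K"
    and tag: "\<And>i. i \<in> A \<Longrightarrow> \<tau> i \<in> K" "\<And>i. i \<in> A \<Longrightarrow> \<tau>' i \<in> K"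
    and disj: "\<And>i j. i \<in> A \<Longrightarrow> j \<in> A \<Longrightarrow> i \<noteq> j \<Longrightarrow> interior (J i) \<inter> interior (J j) = {}"
    and fine: "\<And>i. i \<in> A \<Longrightarrow> J i \<subseteq> max_ball (\<tau> i) (\<delta> (\<tau> i))"
      "\<And>i. i \<in> A \<Longrightarrow> J i \<subseteq> max_ball (\<tau>' i) (\<delta>' (\<tau>' i))"
  shows "(\<Sum>i\<in>A. norm (f (\<tau> i) - f (\<tau>' i)) * measure lborel (J i)) \<le> \<epsilon> + \<epsilon>'"
proof -
  have "(\<Sum>i\<in>A. norm (f (\<tau> i) - f (\<tau>' i)) * measure lborel (J i))
    \<le> (\<Sum>i\<in>A. norm (measure lborel (J i) *\<^sub>R f (\<tau> i) - F (J i)) + norm (measure lborel (J i) *\<^sub>R f (\<tau>' i) - F (J i)))"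
  proof (rule sum_mono)
    fix i
    let ?a = "measure lborel (J i) *\<^sub>R f (\<tau> i)" and ?b = "measure lborel (J i) *\<^sub>R f (\<tau>' i)"
    have "norm (f (\<tau> i) - f (\<tau>' i)) * measure lborel (J i)
        = norm (measure lborel (J i) *\<^sub>R (f (\<tau> i) - f (\<tau>' i)))" by (simp add: mult.commute)
    also have "\<dots> = norm ((?a - F (J i)) - (?b - F (J i)))"
      by (simp add: scaleR_diff_right)
    also have "\<dots> \<le> norm (?a - F (J i)) + norm (?b - F (J i))" by (rule norm_triangle_ineq4)
    finally show "norm (f (\<tau> i) - f (\<tau>' i)) * measure lborel (J i)
        \<le> norm (?a - F (J i)) + norm (?b - F (J i))" .
  qed
  also have "\<dots> \<le> \<epsilon> + \<epsilon>'"
    unfolding sum.distrib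
    using strong_gauge_indexed[where J = J and \<tau> = \<tau>, OF g(1) fin sub tag(1) disj fine(1)]
      strong_gauge_indexed[where J = J and \<tau> = \<tau>', OF g(2) fin sub tag(2) disj fine(2)]
    by linarith
  finally show ?thesis .
qed

text \<open>
  The sum is the \<open>L\<^sup>1\<close> distance of the step functions belonging to the two partitions: the pieces of
  the common refinement inherit a fine tag from either side.
\<close>

lemma strong_gauge_refinement:
  assumes g: "strong_gauge f F K \<epsilon> \<delta>" "strong_gauge f F K \<epsilon>' \<delta>'"
    and P: "M_partition_in P K" "delta_fine \<delta> P" and Q: "M_partition_in Q K" "delta_fine \<delta>' Q"
  shows "(\<Sum>(p, q)\<in>P \<times> Q. norm (f (fst q) - f (fst p)) * measure lborel (snd p \<inter> snd q)) \<le> \<epsilon> + \<epsilon>'"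
proof -
  define A where "A = {(p, q) \<in> P \<times> Q. interior (snd p \<inter> snd q) \<noteq> {}}"
  have fin: "finite P" "finite Q" using P(1) Q(1) by (auto simp: M_partition_in_def)
  have cb: "\<exists>y z. snd p \<inter> snd q = cbox y z" if p: "p \<in> P" and q: "q \<in> Q" for p q
  proof -
    obtain y z y' z' where "snd p = cbox y z" "snd q = cbox y' z'"
      using M_partition_in_piece(4)[OF P(1) p] M_partition_in_piece(4)[OF Q(1) q] by blast
    then show ?thesis by (auto simp only: Int_interval)
  qed
  have "(\<Sum>(p, q)\<in>P \<times> Q. norm (f (fst q) - f (fst p)) * measure lborel (snd p \<inter> snd q))
      = (\<Sum>(p, q)\<in>A. norm (f (fst q) - f (fst p)) * measure lborel (snd p \<inter> snd q))"
  proof (rule sum.mono_neutral_right)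
    show "\<forall>i\<in>P \<times> Q - A. (case i of (p, q) \<Rightarrow> norm (f (fst q) - f (fst p)) * measure lborel (snd p \<inter> snd q)) = 0"
    proof (clarify)
      fix p q t J assume "(p, q) \<in> P" "(t, J) \<in> Q" "((p, q), (t, J)) \<notin> A"
      then have "interior (q \<inter> J) = {}" "\<exists>y z. q \<inter> J = cbox y z"
        using cb[of "(p, q)" "(t, J)"] by (auto simp: A_def)
      then show "norm (f (fst (t, J)) - f (fst (p, q))) * measure lborel (snd (p, q) \<inter> snd (t, J)) = 0"
        by (auto simp: content_eq_0_interior simp del: interior_Int interior_cbox)
    qed
  qed (use fin in \<open>auto simp: A_def\<close>)
  also have "\<dots> = (\<Sum>i\<in>A. norm (f (fst (fst i)) - f (fst (snd i))) * measure lborel (snd (fst i) \<inter> snd (snd i)))"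
    by (simp add: split_beta norm_minus_commute)
  also have "\<dots> \<le> \<epsilon> + \<epsilon>'"
  proof (rule strong_gauge_two_tags[OF g])
    show "finite A" using fin by (auto simp: A_def intro: finite_subset[of _ "P \<times> Q"])
  next
    fix i assume i: "i \<in> A"
    then have iPQ: "fst i \<in> P" "snd i \<in> Q" and int: "interior (snd (fst i) \<inter> snd (snd i)) \<noteq> {}"
      by (auto simp: A_def)
    obtain y z where yz: "snd (fst i) \<inter> snd (snd i) = cbox y z" using cb[OF iPQ] by blast
    show "snd (fst i) \<inter> snd (snd i) \<in> subintervals K"
    proof -
      have "box y z \<noteq> {}" using int unfolding yz interior_cbox .
      moreover have "cbox y z \<subseteq> K"
        using M_partition_in_piece(2)[OF P(1) iPQ(1)] unfolding yz[symmetric] by blast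
      ultimately show ?thesis unfolding yz subintervals_def by blast
    qed
    show "fst (fst i) \<in> K" "fst (snd i) \<in> K"
      using M_partition_in_piece(3) P(1) Q(1) iPQ by blast+
    show "snd (fst i) \<inter> snd (snd i) \<subseteq> max_ball (fst (fst i)) (\<delta> (fst (fst i)))"
      "snd (fst i) \<inter> snd (snd i) \<subseteq> max_ball (fst (snd i)) (\<delta>' (fst (snd i)))"
      using P(2) Q(2) iPQ unfolding delta_fine_def split_beta by blast+
  next
    fix i j assume "i \<in> A" "j \<in> A" "i \<noteq> j"
    then have "fst i \<in> P" "snd i \<in> Q" "fst j \<in> P" "snd j \<in> Q" "fst i \<noteq> fst j \<or> snd i \<noteq> snd j"
      by (auto simp: A_def prod_eq_iff)
    then show "interior (snd (fst i) \<inter> snd (snd i)) \<inter> interior (snd (fst j) \<inter> snd (snd j)) = {}"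
      using M_partition_in_disjoint[OF P(1), of "fst i" "fst j"]
        M_partition_in_disjoint[OF Q(1), of "snd i" "snd j"] by auto
  qed
  finally show ?thesis .
qed

lemma open_max_ball: "open (max_ball t r)"
  unfolding max_ball_def by (intro open_Collect_less continuous_intros)

text \<open>
  A Chebyshev inequality for the set where \<open>f\<close> differs from the step function of \<open>P\<close> by more than
  \<open>\<eta>\<close>. The set is covered by countably many non-overlapping boxes, each inside one interval of \<open>P\<close>
  and fine for a tag in the set. Finitely many of them carry two systems of fine tags, at which the
  values of \<open>f\<close> differ by more than \<open>\<eta>\<close>.
\<close>

lemma strong_gauge_deviation_set:
  fixes f :: "'m::euclidean_space \<Rightarrow> 'x::real_normed_vector"
  assumes ne: "box a b \<noteq> {}" and g: "strong_gauge f F (cbox a b) \<epsilon> \<delta>"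
    and P: "M_partition_in P (cbox a b)" "delta_fine \<delta> P" and \<eta>: "0 < \<eta>" and \<epsilon>: "0 \<le> \<epsilon>"
  obtains C where "C \<in> sets lborel" "emeasure lborel C \<le> ennreal (2 * \<epsilon> / \<eta>)"
    "{t \<in> cbox a b. \<exists>p\<in>P. t \<in> interior (snd p) \<and> \<eta> < norm (f t - f (fst p))} \<subseteq> C"
proof -
  define E where "E = {t \<in> cbox a b. \<exists>p\<in>P. t \<in> interior (snd p) \<and> \<eta> < norm (f t - f (fst p))}"
  have E: "E \<subseteq> cbox a b" by (auto simp: E_def)
  have "\<forall>t\<in>E. \<exists>p. p \<in> P \<and> t \<in> interior (snd p) \<and> \<eta> < norm (f t - f (fst p))"
    unfolding E_def by blast
  from bchoice[OF this] obtain p where "\<forall>t\<in>E. p t \<in> P \<and> t \<in> interior (snd (p t)) \<and> \<eta> < norm (f t - f (fst (p t)))"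
    ..
  then have p: "\<And>t. t \<in> E \<Longrightarrow> p t \<in> P" "\<And>t. t \<in> E \<Longrightarrow> t \<in> interior (snd (p t))"
    "\<And>t. t \<in> E \<Longrightarrow> \<eta> < norm (f t - f (fst (p t)))" by blast+
  define G where "G t = (if t \<in> E then max_ball t (\<delta> t) \<inter> interior (snd (p t)) else UNIV)" for t
  have "t \<in> max_ball t (\<delta> t)" if "t \<in> E" for t
    using g that E by (auto simp: strong_gauge_def gauge_on_def max_ball_def infnorm_0)
  then have G: "gauge G"
    unfolding gauge_def G_def using p(2) by (simp add: open_max_ball open_Int)
  obtain D where D: "countable D" "\<Union>D \<subseteq> cbox a b"
    "\<And>K. K \<in> D \<Longrightarrow> interior K \<noteq> {} \<and> (\<exists>c d. K = cbox c d)"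
    "pairwise (\<lambda>A B. interior A \<inter> interior B = {}) D"
    "\<And>K. K \<in> D \<Longrightarrow> \<exists>x \<in> E \<inter> K. K \<subseteq> G x" "E \<subseteq> \<Union>D"
    by (rule covering_lemma[OF E ne G], rule that)
  then have "\<forall>J\<in>D. \<exists>x. x \<in> E \<and> J \<subseteq> G x" by blast
  from bchoice[OF this] obtain x where "\<forall>J\<in>D. x J \<in> E \<and> J \<subseteq> G (x J)" ..
  then have x: "\<And>J. J \<in> D \<Longrightarrow> x J \<in> E" "\<And>J. J \<in> D \<Longrightarrow> J \<subseteq> G (x J)" by blast+
  have bound: "measure lborel (\<Union>D') \<le> 2 * \<epsilon> / \<eta>" if D': "D' \<subseteq> D" "finite D'" for D'
  proof -
    have "(\<Sum>J\<in>D'. norm (f (x J) - f (fst (p (x J)))) * measure lborel J) \<le> \<epsilon> + \<epsilon>"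
    proof (rule strong_gauge_two_tags[OF g g D'(2)])
      fix J assume "J \<in> D'"
      then have J: "J \<in> D" using D' by blast
      have sub: "J \<subseteq> max_ball (x J) (\<delta> (x J))" "J \<subseteq> snd (p (x J))"
        using x(2)[OF J] x(1)[OF J] interior_subset by (auto simp: G_def)
      show "J \<in> subintervals (cbox a b)"
      proof -
        obtain y z where yz: "J = cbox y z" using D(3)[OF J] by blast
        have "box y z \<noteq> {}" using D(3)[OF J] unfolding yz interior_cbox by blast
        then show ?thesis using D(2) J unfolding yz subintervals_def by blast
      qed
      show "x J \<in> cbox a b" using x(1)[OF J] E by blast
      show "fst (p (x J)) \<in> cbox a b" using M_partition_in_piece(3)[OF P(1) p(1)[OF x(1)[OF J]]] .
      show "J \<subseteq> max_ball (x J) (\<delta> (x J))" by fact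
      show "J \<subseteq> max_ball (fst (p (x J))) (\<delta> (fst (p (x J))))"
        using sub(2) P(2) p(1)[OF x(1)[OF J]] unfolding delta_fine_def split_beta by blast
    next
      fix I J assume "I \<in> D'" "J \<in> D'" "I \<noteq> J"
      then show "interior I \<inter> interior J = {}" using D(4) D'(1) by (auto simp: pairwise_def)
    qed
    moreover have "(\<Sum>J\<in>D'. \<eta> * measure lborel J)
        \<le> (\<Sum>J\<in>D'. norm (f (x J) - f (fst (p (x J)))) * measure lborel J)"
      using p(3) x(1) D'(1) by (intro sum_mono mult_right_mono) (auto intro: less_imp_le)
    ultimately have "\<eta> * (\<Sum>J\<in>D'. measure lborel J) \<le> 2 * \<epsilon>"
      by (simp add: sum_distrib_left)
    then have "(\<Sum>J\<in>D'. measure lborel J) \<le> 2 * \<epsilon> / \<eta>"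
      using \<eta> by (simp add: pos_le_divide_eq mult.commute)
    moreover have "measure lborel (\<Union>D') \<le> (\<Sum>J\<in>D'. measure lborel J)"
      using D(3) D' by (intro measure_Union_le) fastforce+
    ultimately show ?thesis by linarith
  qed
  have fm: "J \<in> fmeasurable lborel" if "J \<in> D" for J using D(3)[OF that] by auto
  have "\<Union>D \<in> fmeasurable lborel" "measure lborel (\<Union>D) \<le> 2 * \<epsilon> / \<eta>"
    using fmeasurable_Union_bound[OF D(1) fm bound] measure_Union_bound[OF D(1) fm bound] by blast+
  then show thesis
    using D(6) unfolding E_def by (intro that[of "\<Union>D"]) (auto simp: fmeasurable_def emeasure_eq_ennreal_measure intro: ennreal_leI)
qed

section \<open>Strongly McShane integrable functions are series of boxes\<close>

text \<open>
  A series of step functions is flattened into a single series of boxes, by numbering the terms of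
  each step function and enumerating \<open>nat \<times> nat\<close>. Absolute convergence almost everywhere justifies
  the rearrangement.
\<close>

lemma box_series_of_step_series:
  fixes X :: "nat \<Rightarrow> 'i \<Rightarrow> 'x::banach" and U V :: "nat \<Rightarrow> 'i \<Rightarrow> 'm::euclidean_space"
  assumes fin: "\<And>n. finite (D n)"
    and sm: "summable (\<lambda>n. \<Sum>i\<in>D n. norm (X n i) * measure lborel (cbox (U n i) (V n i)))"
    and ae: "AE t in lborel. t \<in> K \<longrightarrow>
      (\<lambda>n. \<Sum>i\<in>D n. indicator (cbox (U n i) (V n i)) t *\<^sub>R X n i) sums f t"
  shows "\<exists>x u v. has_box_series f x u v K"
proof -
  have "\<exists>e. bij_betw e {..<card (D n)} (D n)" for n
    using ex_bij_betw_nat_finite[OF fin[of n]] by (simp add: atLeast0LessThan)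
  then obtain e where e: "\<And>n. bij_betw (e n) {..<card (D n)} (D n)" by metis
  define x where "x = (\<lambda>(n, k). if k < card (D n) then X n (e n k) else 0)"
  define u where "u = (\<lambda>(n, k). U n (e n k))"
  define v where "v = (\<lambda>(n, k). V n (e n k))"
  define c where "c p = norm (x p) * measure lborel (cbox (u p) (v p))" for p
  have rows: "((\<lambda>k. G (u (n, k)) (v (n, k)) (x (n, k))) has_sum (\<Sum>i\<in>D n. G (U n i) (V n i) (X n i))) UNIV"
    if "\<And>y z. G y z 0 = 0" for G :: "'m \<Rightarrow> 'm \<Rightarrow> 'x \<Rightarrow> 'z::{comm_monoid_add,topological_space}" and n
  proof (rule has_sum_finite_neutralI[of "{..<card (D n)}"])
    show "(\<Sum>i\<in>D n. G (U n i) (V n i) (X n i)) = (\<Sum>k<card (D n). G (u (n, k)) (v (n, k)) (x (n, k)))"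
      using sum.reindex_bij_betw[OF e[of n], of "\<lambda>i. G (U n i) (V n i) (X n i)", symmetric]
      by (simp add: u_def v_def x_def)
  qed (use that in \<open>auto simp: x_def\<close>)
  have "c summable_on (Sigma UNIV (\<lambda>_. UNIV))"
  proof (rule summable_on_SigmaI)
    show "((\<lambda>k. c (n, k)) has_sum (\<Sum>i\<in>D n. norm (X n i) * measure lborel (cbox (U n i) (V n i)))) UNIV" for n
      unfolding c_def by (rule rows[of "\<lambda>y z w. norm w * measure lborel (cbox y z)"]) simp
    show "(\<lambda>n. \<Sum>i\<in>D n. norm (X n i) * measure lborel (cbox (U n i) (V n i))) summable_on UNIV"
      using sm by (subst summable_on_UNIV_nonneg_real_iff) (auto intro: sum_nonneg)
  qed (simp add: c_def)
  then have "(\<lambda>m. c (prod_decode m)) summable_on UNIV"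
    using summable_on_reindex_bij_betw[OF bij_prod_decode, of c] by simp
  then have smc: "summable (\<lambda>m. norm (x (prod_decode m)) *
      measure lborel (cbox (u (prod_decode m)) (v (prod_decode m))))"
    unfolding c_def by (rule summable_on_imp_summable)
  have "AE t in lborel. t \<in> K \<longrightarrow> (\<lambda>m. indicator (cbox (u (prod_decode m)) (v (prod_decode m))) t
      *\<^sub>R x (prod_decode m)) sums f t"
    using ae AE_summable_indicator_cbox[OF norm_ge_zero smc]
  proof (eventually_elim, intro impI)
    fix t
    let ?h = "\<lambda>p. indicator (cbox (u p) (v p)) t *\<^sub>R x p"
    assume t: "t \<in> K \<longrightarrow> (\<lambda>n. \<Sum>i\<in>D n. indicator (cbox (U n i) (V n i)) t *\<^sub>R X n i) sums f t" "t \<in> K"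
      and abs: "summable (\<lambda>m. norm (x (prod_decode m)) * indicator (cbox (u (prod_decode m)) (v (prod_decode m))) t)"
    have "(\<lambda>m. ?h (prod_decode m)) summable_on UNIV"
      using abs by (intro norm_summable_imp_summable_on) (simp add: mult.commute)
    then obtain L where L: "((\<lambda>m. ?h (prod_decode m)) has_sum L) UNIV" by (auto simp: summable_on_def)
    then have "(?h has_sum L) (Sigma UNIV (\<lambda>_. UNIV))"
      using has_sum_reindex_bij_betw[OF bij_prod_decode, of ?h] by simp
    then have "((\<lambda>n. \<Sum>i\<in>D n. indicator (cbox (U n i) (V n i)) t *\<^sub>R X n i) has_sum L) UNIV"
      by (rule has_sum_SigmaD) (rule rows[of "\<lambda>y z w. indicator (cbox y z) t *\<^sub>R w"], simp)
    then have "L = f t" using t has_sum_imp_sums sums_unique2 by blast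
    then show "(\<lambda>m. ?h (prod_decode m)) sums f t" using has_sum_imp_sums[OF L] by simp
  qed
  then show ?thesis using smc unfolding has_box_series_def
    by (intro exI[of _ "\<lambda>m. x (prod_decode m)"] exI[of _ "\<lambda>m. u (prod_decode m)"]
        exI[of _ "\<lambda>m. v (prod_decode m)"]) simp
qed

text \<open>
  The differences of consecutive step functions sum to \<open>f\<close> almost everywhere. Errors \<open>1/4^n\<close> and
  thresholds \<open>1/2^n\<close> make both the \<open>L\<^sup>1\<close> norms of the differences and the measures of the sets of
  large deviation summable.
\<close>

theorem strong_McShane_primitive_imp_box_series:
  fixes a b :: "'m::euclidean_space" and f :: "'m \<Rightarrow> 'x::banach"
  assumes ne: "box a b \<noteq> {}" and F: "strong_McShane_primitive f F (cbox a b)"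
  shows "\<exists>x u v. has_box_series f x u v (cbox a b)"
proof -
  define K where "K = cbox a b"
  define \<epsilon> where "\<epsilon> n = (1/4::real)^n" for n :: nat
  have "\<exists>\<delta>. strong_gauge f F K (\<epsilon> n) \<delta>" for n
    using F unfolding strong_McShane_primitive_iff_fine_partitions[OF ne] eventually_fine_partitions
      strong_gauge_def K_def by (auto simp: \<epsilon>_def)
  then obtain \<delta> where \<delta>: "\<And>n. strong_gauge f F K (\<epsilon> n) (\<delta> n)" by metis
  have "\<exists>P. M_partition_of P K \<and> delta_fine (\<delta> n) P" for n
    using fine_M_partition_exists[OF ne] \<delta>[of n] unfolding strong_gauge_def K_def by metis
  then obtain P where P_of: "\<And>n. M_partition_of (P n) K" and fine: "\<And>n. delta_fine (\<delta> n) (P n)"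
    by metis
  have P: "M_partition_in (P n) K" and cover: "(\<Union>p\<in>P n. snd p) = K" for n
    using P_of[of n] by (simp_all add: M_partition_of_def split_beta)
  have finP: "finite (P n)" for n using P[of n] by (simp add: M_partition_in_def)
  \<comment> \<open>\<open>X n\<close> on the intersections indexed by \<open>D n\<close> is the \<open>n\<close>-th difference of step functions; the
    pairs \<open>(p, p)\<close> make the first step function itself the term for \<open>n = 0\<close>\<close>
  define D where "D n = (case n of 0 \<Rightarrow> (\<lambda>p. (p, p)) ` P 0 | Suc m \<Rightarrow> P m \<times> P (Suc m))" for n
  define X where "X n i = (case i of (p, q) \<Rightarrow> case n of 0 \<Rightarrow> f (fst q) | Suc m \<Rightarrow> f (fst q) - f (fst p))"
    for n and i :: "('m \<times> 'm set) \<times> ('m \<times> 'm set)"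
  have finD: "finite (D n)" for n using finP by (simp add: D_def split: nat.split)
  have D_sub: "fst i \<in> P (n - 1)" "snd i \<in> P n" if "i \<in> D n" for i n
    using that by (auto simp: D_def split: nat.splits)
  define W where "W i = (SOME w. snd (fst i) \<inter> snd (snd i) = cbox (fst w) (snd w))"
    for i :: "('m \<times> 'm set) \<times> ('m \<times> 'm set)"
  define U where "U n i = fst (W i)" for n :: nat and i
  define V where "V n i = snd (W i)" for n :: nat and i
  have UV: "snd (fst i) \<inter> snd (snd i) = cbox (U n i) (V n i)" if i: "i \<in> D n" for n i
  proof -
    obtain y z y' z' where "snd (fst i) = cbox y z" "snd (snd i) = cbox y' z'"
      using M_partition_in_piece(4)[OF P D_sub(1)[OF i]] M_partition_in_piece(4)[OF P D_sub(2)[OF i]]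
      by blast
    then have "\<exists>w. snd (fst i) \<inter> snd (snd i) = cbox (fst w) (snd w)"
      by (auto simp only: Int_interval fst_conv snd_conv intro!: exI[of _ "(_, _)"])
    then show ?thesis unfolding U_def V_def W_def by (rule someI_ex)
  qed
  have row: "(\<Sum>i\<in>D (Suc n). norm (X (Suc n) i) * measure lborel (cbox (U (Suc n) i) (V (Suc n) i))) \<le> 2 * \<epsilon> n"
    for n
  proof -
    have "(\<Sum>i\<in>D (Suc n). norm (X (Suc n) i) * measure lborel (cbox (U (Suc n) i) (V (Suc n) i)))
      = (\<Sum>(p, q)\<in>P n \<times> P (Suc n). norm (f (fst q) - f (fst p)) * measure lborel (snd p \<inter> snd q))"
    proof (rule sum.cong)
      fix i assume "i \<in> P n \<times> P (Suc n)"
      then have "i \<in> D (Suc n)" by (simp add: D_def)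
      from UV[OF this] show "norm (X (Suc n) i) * measure lborel (cbox (U (Suc n) i) (V (Suc n) i))
        = (case i of (p, q) \<Rightarrow> norm (f (fst q) - f (fst p)) * measure lborel (snd p \<inter> snd q))"
        by (simp add: X_def split_beta)
    qed (simp add: D_def)
    also have "\<dots> \<le> \<epsilon> n + \<epsilon> (Suc n)"
      by (rule strong_gauge_refinement[OF \<delta>[of n] \<delta>[of "Suc n"] P[of n] fine[of n] P[of "Suc n"] fine[of "Suc n"]])
    also have "\<dots> \<le> 2 * \<epsilon> n" by (simp add: \<epsilon>_def)
    finally show ?thesis .
  qed
  have "summable \<epsilon>" unfolding \<epsilon>_def by (rule summable_geometric) simp
  then have sm\<epsilon>: "summable (\<lambda>n. 2 * \<epsilon> n)" by (rule summable_mult)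
  define c where "c n = (\<Sum>i\<in>D n. norm (X n i) * measure lborel (cbox (U n i) (V n i)))" for n
  have c: "0 \<le> c n" "c (Suc n) \<le> 2 * \<epsilon> n" for n
    using row[of n] by (simp_all add: c_def sum_nonneg)
  have "summable (\<lambda>n. c (Suc n))"
    by (rule summable_comparison_test'[OF sm\<epsilon>, of 0]) (use c in auto)
  then have "summable c" by (simp only: summable_Suc_iff)
  then have sm: "summable (\<lambda>n. \<Sum>i\<in>D n. norm (X n i) * measure lborel (cbox (U n i) (V n i)))"
    by (simp only: c_def[abs_def])

  define E where "E n = {t \<in> K. \<exists>p\<in>P n. t \<in> interior (snd p) \<and> (1/2)^n < norm (f t - f (fst p))}" for n
  have "\<exists>C. C \<in> sets lborel \<and> emeasure lborel C \<le> ennreal (2 * (1/2)^n) \<and> E n \<subseteq> C" for n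
  proof -
    have pow: "(1/4::real)^n = (1/2)^n * (1/2)^n" by (simp add: power_mult_distrib[symmetric])
    have eq: "2 * \<epsilon> n / (1/2)^n = 2 * (1/2)^n"
      unfolding \<epsilon>_def pow by simp
    have pos: "0 < (1/2::real)^n" "0 \<le> \<epsilon> n" by (simp_all add: \<epsilon>_def)
    obtain C where "C \<in> sets lborel" "emeasure lborel C \<le> ennreal (2 * \<epsilon> n / (1/2)^n)" "E n \<subseteq> C"
      unfolding E_def K_def
      by (rule strong_gauge_deviation_set[OF ne \<delta>[of n, unfolded K_def] P[of n, unfolded K_def] fine pos])
    then show ?thesis unfolding eq by blast
  qed
  then obtain C where C: "\<And>n. C n \<in> sets lborel" "\<And>n. emeasure lborel (C n) \<le> ennreal (2 * (1/2)^n)"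
    "\<And>n. E n \<subseteq> C n" by metis
  have Cm: "measure lborel (C n) \<le> 2 * (1/2)^n" for n
    unfolding measure_def by (rule enn2real_leI[OF _ C(2)]) simp
  have "AE t in lborel. eventually (\<lambda>n. t \<in> space lborel - C n) sequentially"
  proof (rule borel_cantelli_AE1)
    show "emeasure lborel (C n) < \<infinity>" for n
      using C(2)[of n] by (metis ennreal_less_top infinity_ennreal_def le_less_trans)
    show "summable (\<lambda>n. measure lborel (C n))"
      by (rule summable_comparison_test'[OF summable_mult[OF summable_geometric[of "1/2::real"]], of 0])
        (use Cm in auto)
  qed (rule C(1))
  moreover have "AE t in lborel. \<forall>n. \<forall>p\<in>P n. t \<notin> frontier (snd p)"
    unfolding AE_all_countable
  proof (intro allI AE_finite_allI finP)
    fix n p assume "p \<in> P n"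
    then obtain y z where yz: "snd p = cbox y z" using M_partition_in_piece(4)[OF P] by blast
    show "AE t in lborel. t \<notin> frontier (snd p)"
      unfolding yz by (rule AE_not_in[OF null_sets_frontier_cbox])
  qed
  ultimately have "AE t in lborel. t \<in> K \<longrightarrow>
      (\<lambda>n. \<Sum>i\<in>D n. indicator (cbox (U n i) (V n i)) t *\<^sub>R X n i) sums f t"
  proof (eventually_elim, intro impI)
    fix t assume ev: "eventually (\<lambda>n. t \<in> space lborel - C n) sequentially"
      and front: "\<forall>n. \<forall>p\<in>P n. t \<notin> frontier (snd p)" and t: "t \<in> K"
    have "\<exists>p. p \<in> P n \<and> t \<in> interior (snd p) \<and> (\<forall>q\<in>P n. t \<in> snd q \<longrightarrow> q = p)" for n
    proof -
      have int: "t \<in> interior (snd q)" if "q \<in> P n" "t \<in> snd q" for q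
        using that front closure_subset[of "snd q"] unfolding frontier_def by blast
      obtain p where p: "p \<in> P n" "t \<in> snd p" using cover t by blast
      then show ?thesis using int M_partition_in_disjoint[OF P] by blast
    qed
    then obtain p where p: "\<And>n. p n \<in> P n" "\<And>n. t \<in> interior (snd (p n))"
      "\<And>n q. q \<in> P n \<Longrightarrow> t \<in> snd q \<Longrightarrow> q = p n" by metis
    have tp: "t \<in> snd (p n)" for n using p(2) interior_subset by blast
    let ?s = "\<lambda>n. f (fst (p n))"
    let ?g = "\<lambda>n. \<Sum>i\<in>D n. indicator (cbox (U n i) (V n i)) t *\<^sub>R X n i"
    have g: "?g n = (case n of 0 \<Rightarrow> ?s 0 | Suc m \<Rightarrow> ?s (Suc m) - ?s m)" for n
    proof -
      have pD: "(p (n - 1), p n) \<in> D n" using p(1) by (auto simp: D_def split: nat.split)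
      have "?g n = (\<Sum>i\<in>{(p (n - 1), p n)}. X n i)"
      proof (rule sum.mono_neutral_cong_right[OF finD])
        show "\<forall>i\<in>D n - {(p (n - 1), p n)}. indicator (cbox (U n i) (V n i)) t *\<^sub>R X n i = 0"
        proof
          fix i assume i: "i \<in> D n - {(p (n - 1), p n)}"
          then have "i \<in> D n" by blast
          then have "fst i = p (n - 1) \<and> snd i = p n" if "t \<in> snd (fst i) \<inter> snd (snd i)"
            using that p(3) D_sub by blast
          then have "t \<notin> snd (fst i) \<inter> snd (snd i)" using i by (metis DiffD2 prod.collapse singletonI)
          then show "indicator (cbox (U n i) (V n i)) t *\<^sub>R X n i = 0"
            using UV[OF \<open>i \<in> D n\<close>] by simp
        qed
        have "t \<in> cbox (U n (p (n - 1), p n)) (V n (p (n - 1), p n))"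
          using UV[OF pD] tp by auto
        then show "indicator (cbox (U n i) (V n i)) t *\<^sub>R X n i = X n i"
          if "i \<in> {(p (n - 1), p n)}" for i using that by simp
      qed (use pD in auto)
      then show ?thesis by (simp add: X_def split: nat.split)
    qed
    have partial: "(\<Sum>k<Suc n. ?g k) = ?s n" for n
      by (induction n) (simp_all add: g)
    have "?s \<longlonglongrightarrow> f t"
    proof -
      have "eventually (\<lambda>n. norm (?s n - f t) \<le> (1/2)^n) sequentially"
        using ev
      proof eventually_elim
        case (elim n)
        then have "t \<notin> E n" using C(3) by blast
        then show ?case using p(1,2)[of n] t by (force simp: E_def norm_minus_commute)
      qed
      moreover have "(\<lambda>n. (1/2::real)^n) \<longlonglongrightarrow> 0" by (rule LIMSEQ_power_zero) simp
      ultimately have "(\<lambda>n. ?s n - f t) \<longlonglongrightarrow> 0" by (rule Lim_null_comparison)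
      then show ?thesis by (simp add: LIM_zero_iff)
    qed
    then have "(\<lambda>n. \<Sum>k<Suc n. ?g k) \<longlonglongrightarrow> f t" unfolding partial .
    then show "?g sums f t" unfolding sums_def by (rule LIMSEQ_imp_Suc)
  qed
  then show ?thesis unfolding K_def[symmetric] by (intro box_series_of_step_series[OF finD sm])
qed

theorem strongly_McShane_integrable_iff_box_series:
  fixes f :: "'m::euclidean_space \<Rightarrow> 'x::banach"
  assumes "box a b \<noteq> {}"
  shows "strongly_McShane_integrable f (cbox a b) \<longleftrightarrow> (\<exists>x u v. has_box_series f x u v (cbox a b))"
  unfolding strongly_McShane_integrable_def
  using strong_McShane_primitive_imp_box_series[OF assms]
    box_series_imp_strong_McShane_primitive[OF assms] by blast

lemma McShane_integral_box_series:
  fixes f :: "'m::euclidean_space \<Rightarrow> 'x::banach"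
  assumes "box a b \<noteq> {}" "has_box_series f x u v (cbox a b)"
  shows "McShane_integral (cbox a b) f = (\<Sum>n. measure lborel (cbox (u n) (v n) \<inter> cbox a b) *\<^sub>R x n)"
  by (rule McShane_integral_eq_primitive(2)[OF assms(1) box_series_imp_strong_McShane_primitive[OF assms]])

lemma has_box_series_cong_AE:
  assumes f: "has_box_series f x u v K" and ae: "AE t in lborel. t \<in> K \<longrightarrow> f' t = f t"
  shows "has_box_series f' x u v K"
proof -
  have "AE t in lborel. t \<in> K \<longrightarrow> (\<lambda>n. indicator (cbox (u n) (v n)) t *\<^sub>R x n) sums f t"
    using f by (simp add: has_box_series_def)
  with ae have "AE t in lborel. t \<in> K \<longrightarrow> (\<lambda>n. indicator (cbox (u n) (v n)) t *\<^sub>R x n) sums f' t"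
    by eventually_elim simp
  then show ?thesis using f by (simp add: has_box_series_def)
qed

lemma strongly_McShane_integrable_cong_AE:
  fixes f f' :: "'m::euclidean_space \<Rightarrow> 'x::banach"
  assumes ne: "box a b \<noteq> {}" and f: "strongly_McShane_integrable f (cbox a b)"
    and ae: "AE t in lborel. t \<in> cbox a b \<longrightarrow> f' t = f t"
  shows "strongly_McShane_integrable f' (cbox a b)"
    and "McShane_integral (cbox a b) f' = McShane_integral (cbox a b) f"
proof -
  obtain x u v where s: "has_box_series f x u v (cbox a b)"
    using f strongly_McShane_integrable_iff_box_series[OF ne] by blast
  note s' = has_box_series_cong_AE[OF s ae]
  show "strongly_McShane_integrable f' (cbox a b)"
    using s' strongly_McShane_integrable_iff_box_series[OF ne] by blast
  show "McShane_integral (cbox a b) f' = McShane_integral (cbox a b) f"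
    by (simp only: McShane_integral_box_series[OF ne s] McShane_integral_box_series[OF ne s'])
qed

section \<open>Fubini's theorem for the strong McShane integral\<close>

lemma measure_cbox_prod:
  fixes u v :: "'m::euclidean_space \<times> 'n::euclidean_space"
  shows "measure lborel (cbox u v)
    = measure lborel (cbox (fst u) (fst v)) * measure lborel (cbox (snd u) (snd v))"
  using content_Pair[of "fst u" "snd u" "fst v" "snd v"] by simp

lemma measure_cbox_prod_Int:
  fixes u v :: "'m::euclidean_space \<times> 'n::euclidean_space"
  shows "measure lborel (cbox u v \<inter> cbox (a, c) (b, d))
    = measure lborel (cbox (fst u) (fst v) \<inter> cbox a b) * measure lborel (cbox (snd u) (snd v) \<inter> cbox c d)"
proof -
  obtain y z where 1: "cbox (fst u) (fst v) \<inter> cbox a b = cbox y z" by (rule that[OF Int_interval])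
  obtain y' z' where 2: "cbox (snd u) (snd v) \<inter> cbox c d = cbox y' z'" by (rule that[OF Int_interval])
  have "cbox u v \<inter> cbox (a, c) (b, d) = cbox (y, y') (z, z')"
    unfolding cbox_prod[of u v] cbox_Pair_eq Times_Int_Times 1 2 ..
  then show ?thesis by (simp add: 1 2 content_Pair)
qed

text \<open>
  For almost every \<open>s\<close> the section of the exceptional null set at \<open>s\<close> is null and the series
  \<open>(\<Sum>n. norm (x n) * \<bar>B n\<bar> * indicator (A n) s)\<close> is finite.
\<close>

lemma AE_has_box_series_section:
  fixes f :: "'m::euclidean_space \<times> 'n::euclidean_space \<Rightarrow> 'x::banach"
  assumes f: "has_box_series f x u v (cbox (a, c) (b, d))"
  shows "AE s in lborel. s \<in> cbox a b \<longrightarrow> has_box_series (\<lambda>t. f (s, t))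
    (\<lambda>n. indicator (cbox (fst (u n)) (fst (v n))) s *\<^sub>R x n) (\<lambda>n. snd (u n)) (\<lambda>n. snd (v n)) (cbox c d)"
proof -
  let ?A = "\<lambda>n. cbox (fst (u n)) (fst (v n))" and ?B = "\<lambda>n. cbox (snd (u n)) (snd (v n))"
  have "summable (\<lambda>n. (norm (x n) * measure lborel (?B n)) * measure lborel (?A n))"
    using f by (simp add: has_box_series_def measure_cbox_prod mult_ac)
  then have sm: "AE s in lborel. summable (\<lambda>n. (norm (x n) * measure lborel (?B n)) * indicator (?A n) s)"
    by (intro AE_summable_indicator_cbox) auto
  have "AE z in lborel \<Otimes>\<^sub>M lborel. z \<in> cbox (a, c) (b, d) \<longrightarrow>
      (\<lambda>n. indicator (cbox (u n) (v n)) z *\<^sub>R x n) sums f z"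
    using f unfolding has_box_series_def lborel_prod by blast
  from lborel_pair.AE_pair[OF this]
  have "AE s in lborel. AE t in lborel. (s, t) \<in> cbox (a, c) (b, d) \<longrightarrow>
      (\<lambda>n. indicator (cbox (u n) (v n)) (s, t) *\<^sub>R x n) sums f (s, t)" .
  with sm show ?thesis
  proof (eventually_elim, intro impI)
    fix s assume "summable (\<lambda>n. (norm (x n) * measure lborel (?B n)) * indicator (?A n) s)"
      and ae: "AE t in lborel. (s, t) \<in> cbox (a, c) (b, d) \<longrightarrow>
        (\<lambda>n. indicator (cbox (u n) (v n)) (s, t) *\<^sub>R x n) sums f (s, t)" and s: "s \<in> cbox a b"
    then have "summable (\<lambda>n. norm (indicator (?A n) s *\<^sub>R x n) * measure lborel (?B n))"
      by (simp add: mult_ac)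
    moreover have "AE t in lborel. t \<in> cbox c d \<longrightarrow>
        (\<lambda>n. indicator (?B n) t *\<^sub>R indicator (?A n) s *\<^sub>R x n) sums f (s, t)"
      using ae
    proof eventually_elim
      case (elim t)
      have "indicator (cbox (u n) (v n)) (s, t) = (indicator (?B n) t * indicator (?A n) s :: real)" for n
        unfolding cbox_prod[of "u n"] by (auto simp: indicator_def)
      then have "(\<lambda>n. indicator (cbox (u n) (v n)) (s, t) *\<^sub>R x n)
          = (\<lambda>n. indicator (?B n) t *\<^sub>R indicator (?A n) s *\<^sub>R x n)"
        by (simp only: scaleR_scaleR)
      moreover have "t \<in> cbox c d \<Longrightarrow> (s, t) \<in> cbox (a, c) (b, d)" using s by (simp add: cbox_Pair_eq)
      ultimately show ?case using elim by metis
    qed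
    ultimately show "has_box_series (\<lambda>t. f (s, t)) (\<lambda>n. indicator (?A n) s *\<^sub>R x n)
        (\<lambda>n. snd (u n)) (\<lambda>n. snd (v n)) (cbox c d)"
      by (simp add: has_box_series_def)
  qed
qed

text \<open>
  The sections are integrated term by term. Where a section is not integrable, \<open>g\<close> takes whatever
  value the description operator yields; this concerns a null set only.
\<close>

lemma has_box_series_marginal:
  fixes f :: "'m::euclidean_space \<times> 'n::euclidean_space \<Rightarrow> 'x::banach"
  assumes ne: "box c d \<noteq> {}" and f: "has_box_series f x u v (cbox (a, c) (b, d))"
    and g: "\<And>s. s \<in> cbox a b \<Longrightarrow> g s = McShane_integral (cbox c d) (\<lambda>t. f (s, t))"
  shows "has_box_series g (\<lambda>n. measure lborel (cbox (snd (u n)) (snd (v n)) \<inter> cbox c d) *\<^sub>R x n)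
    (\<lambda>n. fst (u n)) (\<lambda>n. fst (v n)) (cbox a b)"
proof -
  let ?A = "\<lambda>n. cbox (fst (u n)) (fst (v n))" and ?B = "\<lambda>n. cbox (snd (u n)) (snd (v n))"
  have "summable (\<lambda>n. (norm (x n) * measure lborel (?A n)) * measure lborel (?B n))"
    using f by (simp add: has_box_series_def measure_cbox_prod mult_ac)
  then have "summable (\<lambda>n. (norm (x n) * measure lborel (?A n)) * measure lborel (?B n \<inter> cbox c d))"
    by (rule summable_comparison_test'[where N = 0]) (auto intro!: mult_left_mono measure_cbox_Int_le)
  then have sm: "summable (\<lambda>n. norm (measure lborel (?B n \<inter> cbox c d) *\<^sub>R x n) * measure lborel (?A n))"
    by (simp add: mult_ac)
  moreover have "AE s in lborel. s \<in> cbox a b \<longrightarrow>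
      (\<lambda>n. indicator (?A n) s *\<^sub>R measure lborel (?B n \<inter> cbox c d) *\<^sub>R x n) sums g s"
    using AE_has_box_series_section[OF f]
  proof (eventually_elim, intro impI)
    fix s assume s: "s \<in> cbox a b" and "s \<in> cbox a b \<longrightarrow> has_box_series (\<lambda>t. f (s, t))
      (\<lambda>n. indicator (?A n) s *\<^sub>R x n) (\<lambda>n. snd (u n)) (\<lambda>n. snd (v n)) (cbox c d)"
    then have sec: "has_box_series (\<lambda>t. f (s, t))
      (\<lambda>n. indicator (?A n) s *\<^sub>R x n) (\<lambda>n. snd (u n)) (\<lambda>n. snd (v n)) (cbox c d)" by blast
    have "summable (\<lambda>n. norm (indicator (?A n) s *\<^sub>R x n) * measure lborel (?B n))"
      using sec unfolding has_box_series_def by blast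
    from summable_sums[OF summable_box_series_Int(1)[OF this]]
    have "(\<lambda>n. measure lborel (?B n \<inter> cbox c d) *\<^sub>R indicator (?A n) s *\<^sub>R x n) sums g s"
      unfolding g[OF s] McShane_integral_box_series[OF ne sec] .
    then show "(\<lambda>n. indicator (?A n) s *\<^sub>R measure lborel (?B n \<inter> cbox c d) *\<^sub>R x n) sums g s"
      by (simp add: mult.commute)
  qed
  ultimately show ?thesis by (simp add: has_box_series_def)
qed

theorem strongly_McShane_Fubini:
  fixes f :: "'m::euclidean_space \<times> 'n::euclidean_space \<Rightarrow> 'x::banach"
  assumes ne: "box a b \<noteq> {}" "box c d \<noteq> {}"
    and f: "strongly_McShane_integrable f (cbox (a, c) (b, d))"
  shows "AE s in lborel. s \<in> cbox a b \<longrightarrow> strongly_McShane_integrable (\<lambda>t. f (s, t)) (cbox c d)"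
    and "strongly_McShane_integrable (\<lambda>s. McShane_integral (cbox c d) (\<lambda>t. f (s, t))) (cbox a b)"
    and "McShane_integral (cbox a b) (\<lambda>s. McShane_integral (cbox c d) (\<lambda>t. f (s, t)))
      = McShane_integral (cbox (a, c) (b, d)) f"
proof -
  have ne2: "box (a, c) (b, d) \<noteq> {}" using ne by (auto simp: box_prod)
  obtain x u v where s: "has_box_series f x u v (cbox (a, c) (b, d))"
    using f strongly_McShane_integrable_iff_box_series[OF ne2] by blast
  show "AE s in lborel. s \<in> cbox a b \<longrightarrow> strongly_McShane_integrable (\<lambda>t. f (s, t)) (cbox c d)"
    using AE_has_box_series_section[OF s]
    by eventually_elim (use strongly_McShane_integrable_iff_box_series[OF ne(2)] in blast)
  note m = has_box_series_marginal[OF ne(2) s refl]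
  show "strongly_McShane_integrable (\<lambda>s. McShane_integral (cbox c d) (\<lambda>t. f (s, t))) (cbox a b)"
    using m strongly_McShane_integrable_iff_box_series[OF ne(1)] by blast
  show "McShane_integral (cbox a b) (\<lambda>s. McShane_integral (cbox c d) (\<lambda>t. f (s, t)))
      = McShane_integral (cbox (a, c) (b, d)) f"
    unfolding McShane_integral_box_series[OF ne2 s] McShane_integral_box_series[OF ne(1) m]
    by (simp add: measure_cbox_prod_Int)
qed

lemma AE_lborel_swap:
  fixes Q :: "'m::euclidean_space \<times> 'n::euclidean_space \<Rightarrow> bool"
  assumes "AE z in lborel. Q z"
  shows "AE z in lborel. Q (prod.swap z)"
proof -
  have "AE z in distr (lborel \<Otimes>\<^sub>M lborel) (lborel \<Otimes>\<^sub>M lborel) (\<lambda>(x, y). (y, x)). Q z"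
    unfolding lborel_pair.distr_pair_swap[symmetric] unfolding lborel_prod by (rule assms)
  from AE_distrD[OF measurable_pair_swap' this]
  show ?thesis unfolding lborel_prod by (simp add: prod.swap_def split_beta)
qed

lemma strongly_McShane_integrable_swap:
  fixes f :: "'m::euclidean_space \<times> 'n::euclidean_space \<Rightarrow> 'x::banach"
  assumes ne: "box a b \<noteq> {}" "box c d \<noteq> {}"
    and f: "strongly_McShane_integrable f (cbox (a, c) (b, d))"
  shows "strongly_McShane_integrable (\<lambda>z. f (prod.swap z)) (cbox (c, a) (d, b))"
    and "McShane_integral (cbox (c, a) (d, b)) (\<lambda>z. f (prod.swap z)) = McShane_integral (cbox (a, c) (b, d)) f"
proof -
  have ne2: "box (a, c) (b, d) \<noteq> {}" "box (c, a) (d, b) \<noteq> {}" using ne by (auto simp: box_prod)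
  obtain x u v where s: "has_box_series f x u v (cbox (a, c) (b, d))"
    using f strongly_McShane_integrable_iff_box_series[OF ne2(1)] by blast
  let ?u = "\<lambda>n. prod.swap (u n)" and ?v = "\<lambda>n. prod.swap (v n)"
  have ind: "indicator (cbox (u n) (v n)) (prod.swap z) = (indicator (cbox (?u n) (?v n)) z :: real)" for n z
    unfolding cbox_prod by (cases z) (simp add: indicator_def conj_commute)
  have "AE z in lborel. z \<in> cbox (a, c) (b, d) \<longrightarrow> (\<lambda>n. indicator (cbox (u n) (v n)) z *\<^sub>R x n) sums f z"
    using s by (simp add: has_box_series_def)
  from AE_lborel_swap[OF this]
  have "AE z in lborel. z \<in> cbox (c, a) (d, b) \<longrightarrow>
      (\<lambda>n. indicator (cbox (?u n) (?v n)) z *\<^sub>R x n) sums f (prod.swap z)"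
    unfolding ind by eventually_elim (auto simp: cbox_Pair_eq)
  then have s': "has_box_series (\<lambda>z. f (prod.swap z)) x ?u ?v (cbox (c, a) (d, b))"
    using s by (simp add: has_box_series_def measure_cbox_prod mult_ac)
  show "strongly_McShane_integrable (\<lambda>z. f (prod.swap z)) (cbox (c, a) (d, b))"
    using s' strongly_McShane_integrable_iff_box_series[OF ne2(2)] by blast
  show "McShane_integral (cbox (c, a) (d, b)) (\<lambda>z. f (prod.swap z)) = McShane_integral (cbox (a, c) (b, d)) f"
    unfolding McShane_integral_box_series[OF ne2(1) s] McShane_integral_box_series[OF ne2(2) s']
    by (simp add: measure_cbox_prod_Int mult.commute)
qed

lemma AE_lborel_fst:
  assumes "AE s in lborel. Q s"
  shows "AE z in (lborel :: ('m::euclidean_space \<times> 'n::euclidean_space) measure). Q (fst z)"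
proof -
  obtain N where N: "N \<in> null_sets lborel" "{s. \<not> Q s} \<subseteq> N"
    using assms unfolding eventually_ae_filter by auto
  then have "N \<times> UNIV \<in> null_sets (lborel \<Otimes>\<^sub>M (lborel :: 'n measure))"
    by (intro lborel.times_in_null_sets1) auto
  then have "AE z in lborel \<Otimes>\<^sub>M (lborel :: 'n measure). z \<notin> N \<times> UNIV" by (rule AE_not_in)
  then show ?thesis unfolding lborel_prod by eventually_elim (use N(2) in auto)
qed

lemma AE_lborel_snd:
  assumes "AE s in lborel. Q s"
  shows "AE z in (lborel :: ('m::euclidean_space \<times> 'n::euclidean_space) measure). Q (snd z)"
  using AE_lborel_swap[OF AE_lborel_fst[OF assms]] by simp

lemma strongly_McShane_integrable_zero:
  assumes "box a b \<noteq> {}"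
  shows "strongly_McShane_integrable (\<lambda>_. 0 :: 'x::banach) (cbox a b)"
proof -
  have "has_box_series (\<lambda>_. 0 :: 'x) (\<lambda>_. 0) (\<lambda>_. a) (\<lambda>_. a) (cbox a b)"
    by (simp add: has_box_series_def)
  then show ?thesis using strongly_McShane_integrable_iff_box_series[OF assms] by blast
qed

section \<open>Removing the exceptional sections\<close>

theorem theorem2p4:
  fixes f :: "real \<times> real \<Rightarrow> 'x::banach"
    and a1 b1 a2 b2 :: real
  assumes "a1 < b1" and "a2 < b2"
    and "strongly_McShane_integrable f ({a1..b1} \<times> {a2..b2})"
    and "Z1 = {t1 \<in> {a1..b1}. \<not> strongly_McShane_integrable (\<lambda>s2. f (t1, s2)) {a2..b2}}"
    and "Z2 = {t2 \<in> {a2..b2}. \<not> strongly_McShane_integrable (\<lambda>s1. f (s1, t2)) {a1..b1}}"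
    and "Z = (Z1 \<times> {a2..b2}) \<union> ({a1..b1} \<times> Z2)"
    and "f0 = (\<lambda>t. indicator (({a1..b1} \<times> {a2..b2}) - Z) t *\<^sub>R f t)"
    and "g = (\<lambda>t1. McShane_integral {a2..b2} (\<lambda>s2. f0 (t1, s2)))"
    and "h = (\<lambda>t2. McShane_integral {a1..b1} (\<lambda>s1. f0 (s1, t2)))"
  shows
    "(strongly_McShane_integrable f0 ({a1..b1} \<times> {a2..b2}) \<and>
      (\<forall>t1 \<in> {a1..b1}. \<forall>t2 \<in> {a2..b2}.
         strongly_McShane_integrable (\<lambda>s2. f0 (t1, s2)) {a2..b2} \<and>
         strongly_McShane_integrable (\<lambda>s1. f0 (s1, t2)) {a1..b1})) \<and>
     (strongly_McShane_integrable g {a1..b1} \<and>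
      McShane_integral {a1..b1} g = McShane_integral ({a1..b1} \<times> {a2..b2}) f) \<and>
     (strongly_McShane_integrable h {a2..b2} \<and>
      McShane_integral {a2..b2} h = McShane_integral ({a1..b1} \<times> {a2..b2}) f)"
proof -
  have ne: "box a1 b1 \<noteq> {}" "box a2 b2 \<noteq> {}" using assms(1,2) by auto
  have ne2: "box (a1, a2) (b1, b2) \<noteq> {}" using ne by (auto simp: box_prod)
  have K: "{a1..b1} \<times> {a2..b2} = cbox (a1, a2) (b1, b2)"
    by (simp add: cbox_Pair_eq)
  have f: "strongly_McShane_integrable f (cbox (a1, a2) (b1, b2))" using assms(3) K by simp
  note swap = strongly_McShane_integrable_swap[OF ne]
  have Z1: "AE s in lborel. s \<notin> Z1"
    using strongly_McShane_Fubini(1)[OF ne f] by eventually_elim (simp add: assms(4))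
  have Z2: "AE s in lborel. s \<notin> Z2"
    using strongly_McShane_Fubini(1)[OF ne(2,1) swap(1)[OF f]] by eventually_elim (simp add: assms(5))
  have f0: "f0 (s, t) = (if s \<in> Z1 \<or> t \<in> Z2 then 0 else f (s, t))"
    if "s \<in> {a1..b1}" "t \<in> {a2..b2}" for s t
    using that by (auto simp: assms(6,7))
  have "AE z in lborel. z \<in> cbox (a1, a2) (b1, b2) \<longrightarrow> f0 z = f z"
    using AE_lborel_fst[OF Z1] AE_lborel_snd[OF Z2]
  proof eventually_elim
    case (elim z)
    then show ?case unfolding K[symmetric] by (cases z) (auto simp: f0)
  qed
  note f0_int = strongly_McShane_integrable_cong_AE[OF ne2 f this]
  have sec1: "strongly_McShane_integrable (\<lambda>s2. f0 (t1, s2)) {a2..b2}" if t1: "t1 \<in> {a1..b1}" for t1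
  proof (cases "t1 \<in> Z1")
    case True
    have "AE s in lborel. s \<in> cbox a2 b2 \<longrightarrow> f0 (t1, s) = 0" using t1 True f0 by auto
    from strongly_McShane_integrable_cong_AE(1)[OF ne(2) strongly_McShane_integrable_zero[OF ne(2)] this]
    show ?thesis by simp
  next
    case False
    then have "strongly_McShane_integrable (\<lambda>s2. f (t1, s2)) (cbox a2 b2)" using t1 by (simp add: assms(4))
    moreover have "AE s in lborel. s \<in> cbox a2 b2 \<longrightarrow> f0 (t1, s) = f (t1, s)"
      using Z2 by eventually_elim (use t1 False f0 in auto)
    ultimately show ?thesis using strongly_McShane_integrable_cong_AE(1)[OF ne(2)] by simp
  qed
  have sec2: "strongly_McShane_integrable (\<lambda>s1. f0 (s1, t2)) {a1..b1}" if t2: "t2 \<in> {a2..b2}" for t2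
  proof (cases "t2 \<in> Z2")
    case True
    have "AE s in lborel. s \<in> cbox a1 b1 \<longrightarrow> f0 (s, t2) = 0" using t2 True f0 by auto
    from strongly_McShane_integrable_cong_AE(1)[OF ne(1) strongly_McShane_integrable_zero[OF ne(1)] this]
    show ?thesis by simp
  next
    case False
    then have "strongly_McShane_integrable (\<lambda>s1. f (s1, t2)) (cbox a1 b1)" using t2 by (simp add: assms(5))
    moreover have "AE s in lborel. s \<in> cbox a1 b1 \<longrightarrow> f0 (s, t2) = f (s, t2)"
      using Z1 by eventually_elim (use t2 False f0 in auto)
    ultimately show ?thesis using strongly_McShane_integrable_cong_AE(1)[OF ne(1)] by simp
  qed
  have gi: "strongly_McShane_integrable g {a1..b1}"
    "McShane_integral {a1..b1} g = McShane_integral ({a1..b1} \<times> {a2..b2}) f"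
    using strongly_McShane_Fubini(2,3)[OF ne f0_int(1)] f0_int(2)
    unfolding assms(8) K by simp_all
  have hi: "strongly_McShane_integrable h {a2..b2}"
    "McShane_integral {a2..b2} h = McShane_integral ({a1..b1} \<times> {a2..b2}) f"
    using strongly_McShane_Fubini(2,3)[OF ne(2,1) swap(1)[OF f0_int(1)]] swap(2)[OF f0_int(1)] f0_int(2)
    unfolding assms(9) K by simp_all
  show ?thesis using f0_int(1) sec1 sec2 gi hi unfolding K by blast
qed

end
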